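(* Let $r\ge1$. Independently for each prime $p$, choose a symplectic $p$-group $T_p$ at random so that for each symplectic $p$-group $G_p$, $$\operatorname{Prob}(T_p\simeq G_p)=\frac{(\#G_p)^{1-r}}{\#\mathrm{Sp}(G_p)}\prod_{i=r+1}^\infty(1-p^{1-2i}),$$ and let $T=\bigoplus_pT_p$. Then $T$ is finite with probability $1$, and for every symplectic abelian group $G$, $$\operatorname{Prob}(T\simeq G)=\prod_p\left(\frac{(\#G[p^\infty])^{1-r}}{\#\mathrm{Sp}(G[p^\infty])}\prod_{i=r+1}^\infty(1-p^{1-2i})\right),$$ which is the distribution of Delaunay's heuristic assumption for Shafarevich--Tate groups of rank $r$ elliptic curves with $r/2$ replaced by $r$.
   Context: A symplectic abelian group is a finite abelian group $G$ with a nondegenerate alternating bilinear pairing $G\times G\to\mathbb{Q}/\mathbb{Z}$; a symplectic $p$-group is one of $p$-power order; $\mathrm{Sp}(G)$ is the group of pairing-preserving automorphisms. Isomorphism of symplectic abelian groups is equivalent to isomorphism of underlying groups. $G[p^\infty]$ is the $p$-primary part of $G$ (with the restricted pairing). The displayed distribution of $T_p$ is a probability distribution on isomorphism classes of symplectic $p$-groups. *)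

theory Defs
  imports
    "HOL-Probability.Probability"
    "HOL-Algebra.Product_Groups"
    "HOL-Algebra.FiniteProduct"
    "HOL-Algebra.Bij"
begin

text \<open>The group \<open>\<rat>/\<int>\<close>. As everywhere in HOL-Algebra, it and all abelian groups below are
  written multiplicatively.\<close>

definition QZ :: "rat set monoid" where
  "QZ = \<lparr>carrier = UNIV, monoid.mult = (+), one = 0\<rparr> Mod \<int>"

record 'a pairing_group = "'a monoid" +
  pairing :: "'a \<Rightarrow> 'a \<Rightarrow> rat set"

locale symplectic_abelian_group = comm_group G
  for G :: "'a pairing_group" (structure) +
  assumes finite_carrier: "finite (carrier G)"
    and hom_left: "y \<in> carrier G \<Longrightarrow> (\<lambda>x. pairing G x y) \<in> hom G QZ"
    and hom_right: "x \<in> carrier G \<Longrightarrow> (\<lambda>y. pairing G x y) \<in> hom G QZ"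
    and alternating: "x \<in> carrier G \<Longrightarrow> pairing G x x = \<one>\<^bsub>QZ\<^esub>"
    and nondegenerate_left:
      "x \<in> carrier G \<Longrightarrow> (\<And>y. y \<in> carrier G \<Longrightarrow> pairing G x y = \<one>\<^bsub>QZ\<^esub>) \<Longrightarrow> x = \<one>"
    and nondegenerate_right:
      "y \<in> carrier G \<Longrightarrow> (\<And>x. x \<in> carrier G \<Longrightarrow> pairing G x y = \<one>\<^bsub>QZ\<^esub>) \<Longrightarrow> y = \<one>"

definition symplectic_p_group :: "nat \<Rightarrow> 'a pairing_group \<Rightarrow> bool" where
  "symplectic_p_group p G \<longleftrightarrow> symplectic_abelian_group G \<and> (\<exists>k. order G = p ^ k)"

definition preserves_pairing ::
  "'a pairing_group \<Rightarrow> 'b pairing_group \<Rightarrow> ('a \<Rightarrow> 'b) \<Rightarrow> bool" where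
  "preserves_pairing G H f \<longleftrightarrow>
     (\<forall>x\<in>carrier G. \<forall>y\<in>carrier G. pairing H (f x) (f y) = pairing G x y)"

definition symplectic_isomorphic ::
  "'a pairing_group \<Rightarrow> 'b pairing_group \<Rightarrow> bool" (infix \<open>\<simeq>\<^sub>s\<close> 50) where
  "G \<simeq>\<^sub>s H \<longleftrightarrow> (\<exists>f\<in>iso G H. preserves_pairing G H f)"

definition Sp :: "'a pairing_group \<Rightarrow> ('a \<Rightarrow> 'a) set" where
  "Sp G = {f \<in> auto G. preserves_pairing G G f}"

definition primary_part :: "nat \<Rightarrow> 'a pairing_group \<Rightarrow> 'a pairing_group" where
  "primary_part p G = G\<lparr>carrier := {x \<in> carrier G. \<exists>k. x [^]\<^bsub>G\<^esub> (p ^ k :: nat) = \<one>\<^bsub>G\<^esub>}\<rparr>"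

text \<open>The orthogonal direct sum. The pairing of two elements is the sum over \<open>i\<close> of the pairings of
  their \<open>i\<close>-th components; it is taken over the finite support because \<open>finprod\<close> is trivial on
  infinite index sets.\<close>

definition direct_sum :: "'i set \<Rightarrow> ('i \<Rightarrow> 'a pairing_group) \<Rightarrow> ('i \<Rightarrow> 'a) pairing_group" where
  "direct_sum I G =
     monoid.extend (sum_group I G)
       (pairing_group.fields
         (\<lambda>x y. finprod QZ (\<lambda>i. pairing (G i) (x i) (y i)) {i \<in> I. x i \<noteq> \<one>\<^bsub>G i\<^esub>}))"

text \<open>The isomorphism class of \<open>G\<close>. Every finite group has a copy on a set of natural numbers, so
  nothing is lost by taking the representatives of this type.\<close>

definition iso_class :: "'a pairing_group \<Rightarrow> nat pairing_group set" where
  "iso_class G = {H. symplectic_abelian_group H \<and> H \<simeq>\<^sub>s G}"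

definition local_prob :: "nat \<Rightarrow> nat \<Rightarrow> 'a pairing_group \<Rightarrow> real" where
  "local_prob r p G =
     real (order G) powi (1 - int r) / real (card (Sp G)) *
     (\<Prod>j. 1 - real p powi (1 - 2 * int (r + 1 + j)))"

text \<open>Delaunay's heuristic distribution with parameter \<open>u\<close>: the probability distribution on
  isomorphism classes of symplectic abelian groups that gives \<open>G\<close> a weight proportional to
  \<open>(#G)\<^sup>1\<^sup>-\<^sup>u / #Sp(G)\<close>. Delaunay used \<open>u = r/2\<close> for elliptic curves of rank \<open>r\<close>.\<close>

definition delaunay_weight :: "real \<Rightarrow> 'a pairing_group \<Rightarrow> real" where
  "delaunay_weight u G = real (order G) powr (1 - u) / real (card (Sp G))"

definition delaunay_prob :: "real \<Rightarrow> 'a pairing_group \<Rightarrow> real" where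
  "delaunay_prob u G =
     delaunay_weight u G /
     (\<Sum>\<^sub>\<infinity>C \<in> iso_class ` {H :: nat pairing_group. symplectic_abelian_group H}.
        delaunay_weight u (SOME H. H \<in> C))"

end

theory Submission
  imports Defs "HOL-Algebra.Sylow" "HOL-Algebra.Multiplicative_Group"
begin

text \<open>Distinct primary parts of a symplectic abelian group \<open>G\<close> are orthogonal, so \<open>G\<close> is the orthogonal
  direct sum of its primary parts; hence \<open>T \<simeq>\<^sub>s G\<close> iff \<open>T\<^sub>p \<simeq>\<^sub>s G[p\<^sup>\<infinity>]\<close> for every prime \<open>p\<close>, and by independence
  the probability of this event is the product of the local probabilities. The probability that
  \<open>T\<^sub>p\<close> is nontrivial is at most \<open>1 / p\<^sup>2\<close>, so almost surely only finitely many \<open>T\<^sub>p\<close> are nontrivial, by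
  Borel--Cantelli. Since \<open>#G\<close> and \<open>#Sp(G)\<close> are multiplicative over the primary parts, the product equals
  \<open>c (#G)\<^sup>1\<^sup>-\<^sup>r / #Sp(G)\<close> with \<open>c\<close> independent of \<open>G\<close>; as \<open>T\<close> is almost surely finite, the probabilities
  of the countably many isomorphism classes add up to 1, which identifies \<open>c\<close> as the normalising
  constant of Delaunay's distribution.\<close>

section \<open>Isomorphism of symplectic abelian groups\<close>

text \<open>Groups over several types meet: the summands, their sum, and the arbitrary
  \<open>G\<close>. Isomorphism is therefore tested on classes of groups over \<open>nat\<close>;
  copies on \<open>{..<n}\<close> carry the given law to every type and make the classes countable.
  Countability serves twice: finiteness of the sum becomes an event, being a countable union of
  events, and the probabilities of the classes can be added. One gluing map, the product of
  isomorphisms \<open>f p\<close> from \<open>T p\<close> onto the p-parts, yields the structural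
  facts: with the given isomorphisms it identifies the sum with \<open>G\<close>, with identities it
  shows that the order is multiplicative, and with arbitrary automorphisms of the parts it produces
  an automorphism of \<open>G\<close> restricting to them. The bound 1 / p^2 comes from the trivial
  group, whose local probability is the Euler factor alone. By the Weierstrass inequality this is at
  least 1 minus the sum of p^(-(2r + 1 + 2j)) over j \<ge> 0, and r \<ge> 1 makes every exponent at
  least 3. The same bound makes the product of the Euler factors over all primes converge.\<close>

lemma comm_group_QZ: "comm_group QZ"
proof -
  have "comm_group \<lparr>carrier = UNIV, monoid.mult = (+), one = 0 :: rat\<rparr>"
    by (rule comm_groupI) (auto simp: add.assoc add.commute intro!: exI[of _ "- _"])
  moreover have "subgroup \<int> \<lparr>carrier = UNIV, monoid.mult = (+), one = 0 :: rat\<rparr>"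
  proof (rule group.subgroupI)
    fix a :: rat assume "a \<in> \<int>"
    have "inv\<^bsub>\<lparr>carrier = UNIV, monoid.mult = (+), one = 0 :: rat\<rparr>\<^esub> a = - a"
      using calculation by (intro group.inv_equality) (auto simp: comm_group_def)
    with \<open>a \<in> \<int>\<close> show "inv\<^bsub>\<lparr>carrier = UNIV, monoid.mult = (+), one = 0 :: rat\<rparr>\<^esub> a \<in> \<int>"
      by simp
  qed (use calculation in \<open>auto simp: comm_group_def\<close>)
  ultimately show ?thesis
    unfolding QZ_def by (rule comm_group.abelian_FactGroup)
qed

interpretation QZ: comm_group QZ
  by (rule comm_group_QZ)

text \<open>Values of a pairing can thus be coded by natural numbers, as
  \<open>countable_iso_classes\<close> requires.\<close>

lemma countable_carrier_QZ: "countable (carrier QZ)"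
  by (simp add: QZ_def FactGroup_def RCOSETS_def)

lemma symplectic_isomorphicI:
  "f \<in> iso G H \<Longrightarrow> preserves_pairing G H f \<Longrightarrow> G \<simeq>\<^sub>s H"
  by (auto simp: symplectic_isomorphic_def)

lemma symplectic_isomorphicE:
  assumes "G \<simeq>\<^sub>s H"
  obtains f where "f \<in> iso G H" "preserves_pairing G H f"
  using assms by (auto simp: symplectic_isomorphic_def)

lemma preserves_pairing_inv_into:
  assumes "bij_betw f (carrier G) (carrier H)" "preserves_pairing G H f"
  shows "preserves_pairing H G (inv_into (carrier G) f)"
  unfolding preserves_pairing_def
proof (intro ballI)
  fix x y assume xy: "x \<in> carrier H" "y \<in> carrier H"
  define x' y' where "x' = inv_into (carrier G) f x" and "y' = inv_into (carrier G) f y"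
  have "x' \<in> carrier G" "y' \<in> carrier G" "f x' = x" "f y' = y"
    using assms(1) xy bij_betwE[OF bij_betw_inv_into[OF assms(1)]]
    by (auto simp: x'_def y'_def bij_betw_inv_into_right)
  then show "pairing G (inv_into (carrier G) f x) (inv_into (carrier G) f y) = pairing H x y"
    using assms(2) by (auto simp: preserves_pairing_def simp flip: x'_def y'_def)
qed

lemma preserves_pairing_comp:
  assumes "f \<in> carrier G \<rightarrow> carrier H" "preserves_pairing G H f" "preserves_pairing H K g"
  shows "preserves_pairing G K (g \<circ> f)"
  using assms by (auto simp: preserves_pairing_def Pi_iff)

lemma symplectic_isomorphic_refl: "G \<simeq>\<^sub>s G"
  by (rule symplectic_isomorphicI[OF iso_set_refl]) (simp add: preserves_pairing_def)

lemma symplectic_isomorphic_sym: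
  assumes "group G" "G \<simeq>\<^sub>s H"
  shows "H \<simeq>\<^sub>s G"
  using assms(2)
  by (rule symplectic_isomorphicE)
    (auto simp: iso_def intro!: symplectic_isomorphicI group.iso_set_sym[OF assms(1)]
        preserves_pairing_inv_into)

lemma symplectic_isomorphic_trans:
  assumes "G \<simeq>\<^sub>s H" "H \<simeq>\<^sub>s K"
  shows "G \<simeq>\<^sub>s K"
proof -
  obtain f g where f: "f \<in> iso G H" "preserves_pairing G H f"
    and g: "g \<in> iso H K" "preserves_pairing H K g"
    using assms by (auto simp: symplectic_isomorphic_def)
  have "f \<in> carrier G \<rightarrow> carrier H"
    using f(1) by (auto simp: iso_def hom_def)
  then show ?thesis
    using f g by (intro symplectic_isomorphicI[of "g \<circ> f"] iso_set_trans preserves_pairing_comp)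
qed

text \<open>Transport of structure. Membership in \<open>iso\<close> constrains the carrier and the
  multiplication of \<open>H\<close> but not its field \<open>one\<close>, hence the premise
  \<open>monoid H\<close>.\<close>

lemma symplectic_abelian_group_iso:
  assumes "symplectic_abelian_group G" "G \<simeq>\<^sub>s H" "monoid H"
  shows "symplectic_abelian_group H"
proof -
  interpret G: symplectic_abelian_group G by fact
  obtain f where f: "f \<in> iso G H" and pres: "preserves_pairing G H f"
    using assms(2) by (rule symplectic_isomorphicE)
  interpret H: comm_group H
    using G.iso_imp_comm_group[OF is_isoI[OF f] assms(3)] .
  have mult: "f (x \<otimes>\<^bsub>G\<^esub> y) = f x \<otimes>\<^bsub>H\<^esub> f y" if "x \<in> carrier G" "y \<in> carrier G" for x y
    using f that by (auto simp: iso_def hom_def)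
  have one: "f \<one>\<^bsub>G\<^esub> = \<one>\<^bsub>H\<^esub>"
    using f G.is_group H.is_group hom_one[of f G H] by (auto simp: iso_def)
  have carr: "carrier H = f ` carrier G"
    using f by (auto simp: iso_def bij_betw_def)
  have pair: "pairing H (f x) (f y) = pairing G x y" if "x \<in> carrier G" "y \<in> carrier G" for x y
    using pres that by (simp add: preserves_pairing_def)
  show ?thesis
  proof
    show "finite (carrier H)"
      by (simp add: carr G.finite_carrier)
    show "(\<lambda>x. pairing H x y) \<in> hom H QZ" if y: "y \<in> carrier H" for y
    proof -
      obtain y' where y': "y' \<in> carrier G" "y = f y'" using y carr by auto
      show ?thesis
        using G.hom_left[OF y'(1)] y'
        by (auto simp: hom_def carr Pi_iff pair mult[symmetric])
    qed
    show "pairing H x \<in> hom H QZ" if x: "x \<in> carrier H" for x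
    proof -
      obtain x' where x': "x' \<in> carrier G" "x = f x'" using x carr by auto
      show ?thesis
        using G.hom_right[OF x'(1)] x'
        by (auto simp: hom_def carr Pi_iff pair mult[symmetric])
    qed
    show "pairing H x x = \<one>\<^bsub>QZ\<^esub>" if "x \<in> carrier H" for x
      using that G.alternating by (auto simp: carr pair)
    show "x = \<one>\<^bsub>H\<^esub>" if x: "x \<in> carrier H"
      and orth: "\<And>y. y \<in> carrier H \<Longrightarrow> pairing H x y = \<one>\<^bsub>QZ\<^esub>" for x
    proof -
      obtain x' where x': "x' \<in> carrier G" "x = f x'" using x carr by auto
      have "pairing G x' y = \<one>\<^bsub>QZ\<^esub>" if "y \<in> carrier G" for y
        using orth[of "f y"] that x' by (simp add: carr pair)
      then show ?thesis
        using G.nondegenerate_left x' one by auto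
    qed
    show "y = \<one>\<^bsub>H\<^esub>" if y: "y \<in> carrier H"
      and orth: "\<And>x. x \<in> carrier H \<Longrightarrow> pairing H x y = \<one>\<^bsub>QZ\<^esub>" for y
    proof -
      obtain y' where y': "y' \<in> carrier G" "y = f y'" using y carr by auto
      have "pairing G x y' = \<one>\<^bsub>QZ\<^esub>" if "x \<in> carrier G" for x
        using orth[of "f x"] that y' by (simp add: carr pair)
      then show ?thesis
        using G.nondegenerate_right y' one by auto
    qed
  qed
qed

text \<open>The structure is pulled over to \<open>{..<order G}\<close> along an enumeration of the
  carrier. The copy links groups of arbitrary type with \<open>iso_class\<close>, and its explicit
  carrier permits coding by finite tables.\<close>

lemma ex_nat_copy:
  fixes G :: "'a pairing_group"
  assumes "symplectic_abelian_group G"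
  shows "\<exists>H :: nat pairing_group. symplectic_abelian_group H \<and> H \<simeq>\<^sub>s G \<and>
    carrier H = {..<order G}"
proof -
  interpret G: symplectic_abelian_group G by fact
  obtain f where f: "bij_betw f (carrier G) {..<order G}"
    using ex_bij_betw_finite_nat[OF G.finite_carrier] by (auto simp: order_def atLeast0LessThan)
  define g where "g = inv_into (carrier G) f"
  have gf: "g (f x) = x" if "x \<in> carrier G" for x
    using f that by (simp add: g_def bij_betw_inv_into_left)
  have img: "f ` carrier G = {..<order G}"
    using f by (simp add: bij_betw_def)
  define H :: "nat pairing_group" where
    "H = \<lparr>carrier = {..<order G}, monoid.mult = (\<lambda>x y. f (g x \<otimes>\<^bsub>G\<^esub> g y)), one = f \<one>\<^bsub>G\<^esub>,
      pairing = (\<lambda>x y. pairing G (g x) (g y))\<rparr>"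
  have iso: "f \<in> iso G H"
    using f by (auto simp: iso_def hom_def H_def bij_betwE gf img[symmetric])
  have "preserves_pairing G H f"
    by (simp add: preserves_pairing_def H_def gf)
  with iso have GH: "G \<simeq>\<^sub>s H"
    by (rule symplectic_isomorphicI)
  have "monoid H"
    by (rule monoidI) (auto simp: H_def img[symmetric] gf G.m_assoc)
  with GH have "symplectic_abelian_group H" "H \<simeq>\<^sub>s G"
    using symplectic_abelian_group_iso[OF assms] symplectic_isomorphic_sym[OF G.is_group] by auto
  then show ?thesis
    by (auto simp: H_def intro!: exI[of _ H])
qed

text \<open>The two groups may have different types, so equality of classes is exploited through a
  common member over \<open>nat\<close>, which \<open>ex_nat_copy\<close> provides.\<close>

lemma iso_class_eq_iff:
  fixes G :: "'a pairing_group" and H :: "'b pairing_group"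
  assumes "symplectic_abelian_group G" "symplectic_abelian_group H"
  shows "iso_class G = iso_class H \<longleftrightarrow> G \<simeq>\<^sub>s H"
proof
  interpret G: symplectic_abelian_group G by fact
  interpret H: symplectic_abelian_group H by fact
  {
    assume "iso_class G = iso_class H"
    moreover obtain K :: "nat pairing_group" where K: "symplectic_abelian_group K" "K \<simeq>\<^sub>s G"
      using ex_nat_copy[OF assms(1)] by blast
    ultimately have "K \<simeq>\<^sub>s H"
      by (auto simp: iso_class_def)
    moreover have "G \<simeq>\<^sub>s K"
      using K by (auto simp: symplectic_abelian_group_def comm_group_def intro: symplectic_isomorphic_sym)
    ultimately show "G \<simeq>\<^sub>s H"
      by (rule symplectic_isomorphic_trans[rotated])
  }
  assume "G \<simeq>\<^sub>s H"
  moreover from this have "H \<simeq>\<^sub>s G"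
    by (rule symplectic_isomorphic_sym[OF G.is_group])
  ultimately show "iso_class G = iso_class H"
    unfolding iso_class_def by (blast intro: symplectic_isomorphic_trans)
qed

text \<open>A group with carrier \<open>{..<n}\<close> is, up to its junk values outside the carrier, given by its unit
  and its finite tables for the multiplication and the pairing.\<close>

lemma countable_iso_classes:
  "countable (iso_class ` {H :: nat pairing_group. symplectic_abelian_group H})"
proof -
  define dec :: "nat \<times> nat \<times> nat list list \<times> nat list list \<Rightarrow> nat pairing_group" where
    "dec = (\<lambda>(n, e, t, b). \<lparr>carrier = {..<n}, monoid.mult = (\<lambda>x y. t ! x ! y), one = e,
       pairing = (\<lambda>x y. from_nat_into (carrier QZ) (b ! x ! y))\<rparr>)"
  have "iso_class H \<in> range (iso_class \<circ> dec)" if "symplectic_abelian_group H"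
    for H :: "nat pairing_group"
  proof -
    obtain K :: "nat pairing_group" where K: "symplectic_abelian_group K" "K \<simeq>\<^sub>s H"
      and carr: "carrier K = {..<order H}"
      using ex_nat_copy[OF \<open>symplectic_abelian_group H\<close>] by blast
    interpret K: symplectic_abelian_group K by fact
    define n where "n = order H"
    define t where "t = map (\<lambda>x. map (\<lambda>y. x \<otimes>\<^bsub>K\<^esub> y) [0..<n]) [0..<n]"
    define b where "b = map (\<lambda>x. map (\<lambda>y. to_nat_on (carrier QZ) (pairing K x y)) [0..<n]) [0..<n]"
    define L where "L = dec (n, \<one>\<^bsub>K\<^esub>, t, b)"
    have carr: "carrier K = {..<n}" and [simp]: "carrier L = carrier K"
      and [simp]: "\<one>\<^bsub>L\<^esub> = \<one>\<^bsub>K\<^esub>"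
      using carr by (auto simp: n_def L_def dec_def)
    have mult: "x \<otimes>\<^bsub>L\<^esub> y = x \<otimes>\<^bsub>K\<^esub> y" if "x \<in> carrier K" "y \<in> carrier K" for x y
      using that by (simp add: L_def dec_def t_def carr)
    have pair: "pairing L x y = pairing K x y" if "x \<in> carrier K" "y \<in> carrier K" for x y
    proof -
      have "pairing K x y \<in> carrier QZ"
        using K.hom_left[OF that(2)] that(1) by (auto simp: hom_def)
      then show ?thesis
        using that countable_carrier_QZ by (simp add: L_def dec_def b_def carr)
    qed
    \<comment> \<open>The records \<open>K\<close> and \<open>L\<close> may differ outside the
      carrier, so they are related by the identity map and not by equality.\<close>
    have KL: "K \<simeq>\<^sub>s L"
      by (rule symplectic_isomorphicI[of id])
        (auto simp: iso_def hom_def preserves_pairing_def mult pair)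
    have "monoid L"
      by (rule monoidI) (auto simp: mult K.m_assoc)
    then have "symplectic_abelian_group L"
      by (rule symplectic_abelian_group_iso[OF K(1) KL])
    then have "iso_class H = iso_class L"
      using KL K that iso_class_eq_iff by metis
    then show ?thesis
      by (auto simp: L_def)
  qed
  then have "iso_class ` {H :: nat pairing_group. symplectic_abelian_group H} \<subseteq> range (iso_class \<circ> dec)"
    by (simp add: image_subset_iff)
  then show ?thesis
    by (rule countable_subset) (rule countable_image[OF countableI_type])
qed

section \<open>Primary parts\<close>

text \<open>With \<open>m * u = n * v + 1\<close> one gets x = x^(n v + 1) = x^(m u) = 1. This form
  of Bezout over the naturals needs m \<noteq> 0; for m = 0 coprimality forces n = 1.\<close>

lemma (in group) eq_one_if_coprime_powers:
  assumes "x \<in> carrier G" "x [^] (m::nat) = \<one>" "x [^] (n::nat) = \<one>" "coprime m n"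
  shows "x = \<one>"
proof (cases "m = 0")
  case True
  then show ?thesis using assms by simp
next
  case False
  then obtain u v where "m * u = n * v + 1"
    using bezout_nat[of m n] \<open>coprime m n\<close> by auto
  moreover have "x [^] (m * u) = \<one>" "x [^] (n * v + 1) = x"
    using assms by (simp_all add: nat_pow_pow[symmetric] nat_pow_mult[symmetric])
  ultimately show ?thesis by simp
qed

lemma hom_nat_pow:
  assumes "h \<in> hom G H" "group G" "group H" "x \<in> carrier G"
  shows "h (x [^]\<^bsub>G\<^esub> (n::nat)) = h x [^]\<^bsub>H\<^esub> n"
proof -
  interpret G: group G by fact
  interpret H: group H by fact
  show ?thesis
    using assms by (induction n) (auto simp: hom_one hom_mult)
qed

lemma hom_finprod:
  assumes "h \<in> hom G H" "comm_group G" "comm_group H" "f \<in> A \<rightarrow> carrier G"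
  shows "h (finprod G f A) = finprod H (\<lambda>i. h (f i)) A"
proof -
  interpret G: comm_group G by fact
  interpret H: comm_group H by fact
  have h: "h x \<in> carrier H" if "x \<in> carrier G" for x
    using assms(1) that by (auto simp: hom_def)
  have one: "h \<one>\<^bsub>G\<^esub> = \<one>\<^bsub>H\<^esub>"
    using assms(1) by (rule hom_one) unfold_locales
  show ?thesis
    using assms(4)
  proof (induction A rule: infinite_finite_induct)
    case (insert a A)
    then show ?case
      using h assms(1) by (simp add: hom_mult Pi_iff)
  qed (simp_all add: one)
qed

text \<open>Induction on \<open>S\<close>, splitting off the p-part of \<open>n\<close>. Both
  \<open>n\<close> and \<open>x\<close> vary, since the induction hypothesis is applied to the
  cofactor of the p-part and to a power of \<open>x\<close> killed by it.\<close>

lemma (in comm_group) prime_power_decomposition: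
  fixes n :: nat
  assumes "finite S" "\<And>p. p \<in> S \<Longrightarrow> prime p" "n > 0" "\<And>p. prime p \<Longrightarrow> p dvd n \<Longrightarrow> p \<in> S"
    and "x \<in> carrier G" "x [^] n = \<one>"
  obtains y where "y \<in> S \<rightarrow> carrier G" "\<And>p. p \<in> S \<Longrightarrow> \<exists>k. y p [^] (p ^ k) = \<one>"
    "x = finprod G y S"
proof -
  have "\<exists>y. y \<in> S \<rightarrow> carrier G \<and> (\<forall>p\<in>S. \<exists>k. y p [^] (p ^ k) = \<one>) \<and> x = finprod G y S"
    using assms
  proof (induction S arbitrary: n x)
    case empty
    then have "n = 1"
      by (metis empty_iff prime_factor_nat)
    with empty show ?case by simp
  next
    case (insert p S)
    have "prime p" using insert.prems by simp
    then obtain m where n: "n = p ^ multiplicity p n * m" and "\<not> p dvd m"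
      using multiplicity_decompose'[of n p] \<open>n > 0\<close> by (metis not_prime_unit neq0_conv)
    define q where "q = p ^ multiplicity p n"
    have n: "n = q * m" using n by (simp add: q_def)
    have "coprime p m"
      using \<open>prime p\<close> \<open>\<not> p dvd m\<close> by (simp add: prime_imp_coprime)
    then have "coprime (int q) (int m)"
      by (simp add: q_def)
    \<comment> \<open>Bezout over the integers: x is the product of x^(v m), which is killed by the
      p-power q, and x^(u q), which is killed by m. All primes dividing m lie in
      \<open>S\<close>.\<close>
    then obtain u v where uv: "u * int q + v * int m = 1"
      using bezout_int[of "int q" "int m"] by auto
    define z where "z = x [^] (u * int q)"
    define w where "w = x [^] (v * int m)"
    have zw: "z \<in> carrier G" "w \<in> carrier G"
      using insert.prems by (simp_all add: z_def w_def)
    have x: "x = w \<otimes> z"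
      using uv insert.prems(4) int_pow_mult[of x "v * int m" "u * int q"]
      by (simp add: z_def w_def add.commute)
    have xn: "x [^] (int q * int m) = \<one>"
      using insert.prems n by (simp flip: int_pow_int add: mult.commute)
    have "z [^] m = x [^] ((int q * int m) * u)"
      using insert.prems by (simp add: z_def int_pow_pow mult_ac flip: int_pow_int)
    also have "\<dots> = \<one>"
      using insert.prems xn by (simp flip: int_pow_pow)
    finally have "z [^] m = \<one>" .
    moreover have "r \<in> S" if "prime r" "r dvd m" for r
      using insert.prems(3)[of r] that n \<open>\<not> p dvd m\<close> by auto
    moreover have "m > 0" using n \<open>n > 0\<close> by simp
    ultimately obtain y where y: "y \<in> S \<rightarrow> carrier G"
      "\<forall>p\<in>S. \<exists>k. y p [^] (p ^ k) = \<one>" "z = finprod G y S"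
      using insert.IH[of m z] insert.prems(1) zw by blast
    have "w [^] q = x [^] ((int q * int m) * v)"
      using insert.prems by (simp add: w_def int_pow_pow mult_ac flip: int_pow_int)
    also have "\<dots> = \<one>"
      using insert.prems xn by (simp flip: int_pow_pow)
    finally have wq: "w [^] q = \<one>" .
    define y' where "y' = y(p := w)"
    have "finprod G y' S = finprod G y S"
      using insert.hyps y(1) by (intro finprod_cong') (auto simp: y'_def)
    then have "x = finprod G y' (insert p S)"
      using insert.hyps y zw x by (subst finprod_insert) (auto simp: y'_def)
    moreover have "y' \<in> insert p S \<rightarrow> carrier G"
      using y zw by (auto simp: y'_def)
    moreover have "\<forall>r\<in>insert p S. \<exists>k. y' r [^] (r ^ k) = \<one>"
      using y wq by (auto simp: y'_def q_def)
    ultimately show ?case by blast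
  qed
  with that show ?thesis by blast
qed

text \<open>If another prime q divided the order, Cauchy's theorem would give an element of order q,
  killed by q and by a power of p, hence trivial.\<close>

lemma (in group) order_eq_prime_power:
  fixes p :: nat
  assumes "finite (carrier G)" "prime p" "\<And>x. x \<in> carrier G \<Longrightarrow> \<exists>k. x [^] (p ^ k) = \<one>"
  shows "\<exists>k. order G = p ^ k"
proof -
  have "order G > 0"
    using assms(1) by (simp add: order_gt_0_iff_finite)
  then obtain m where m: "order G = p ^ multiplicity p (order G) * m" and "\<not> p dvd m"
    using multiplicity_decompose'[of "order G" p] \<open>prime p\<close> by (metis not_prime_unit neq0_conv)
  have "m = 1"
  proof (rule ccontr)
    assume "m \<noteq> 1"
    then obtain q where q: "prime q" "q dvd m"
      using prime_factor_nat by blast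
    then have "coprime q p"
      using \<open>prime p\<close> \<open>\<not> p dvd m\<close> by (metis primes_coprime)
    have "q dvd order G" using m q(2) by (metis dvd_mult)
    \<comment> \<open>Only the first power of q is split off: Sylow's theorem for q^1 is Cauchy's
      theorem.\<close>
    then obtain t where t: "order G = q ^ 1 * t"
      by auto
    obtain K where K: "subgroup K G" "card K = q ^ 1"
      using sylow_thm[OF q(1) is_group t assms(1)] by blast
    have "K \<noteq> {\<one>}"
      using K(2) prime_gt_1_nat[OF q(1)] by auto
    then obtain h where h: "h \<in> K" "h \<noteq> \<one>"
      using subgroup.one_closed[OF K(1)] by blast
    have "h [^]\<^bsub>G\<lparr>carrier := K\<rparr>\<^esub> order (G\<lparr>carrier := K\<rparr>) = \<one>\<^bsub>G\<lparr>carrier := K\<rparr>\<^esub>"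
      using h K(1) subgroup.subgroup_is_group[OF K(1) is_group]
      by (intro group.pow_order_eq_1) auto
    then have "h [^] (q ^ 1) = \<one>"
      using K(2) by (simp add: order_def flip: nat_pow_consistent)
    moreover obtain k where "h [^] (p ^ k) = \<one>"
      using assms(3) h(1) subgroup.mem_carrier[OF K(1)] by blast
    moreover have "coprime (q ^ 1) (p ^ k)"
      using \<open>coprime q p\<close> by simp
    ultimately show False
      using eq_one_if_coprime_powers h subgroup.mem_carrier[OF K(1)] by blast
  qed
  with m show ?thesis by auto
qed

lemma mem_primary_part:
  "x \<in> carrier (primary_part p G) \<longleftrightarrow> x \<in> carrier G \<and> (\<exists>k. x [^]\<^bsub>G\<^esub> (p ^ k :: nat) = \<one>\<^bsub>G\<^esub>)"
  by (simp add: primary_part_def)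

lemma primary_part_simps [simp]:
  "\<one>\<^bsub>primary_part p G\<^esub> = \<one>\<^bsub>G\<^esub>"
  "x \<otimes>\<^bsub>primary_part p G\<^esub> y = x \<otimes>\<^bsub>G\<^esub> y"
  "pairing (primary_part p G) = pairing G"
  by (simp_all add: primary_part_def)

lemma nat_pow_primary_part [simp]: "x [^]\<^bsub>primary_part p G\<^esub> (n::nat) = x [^]\<^bsub>G\<^esub> n"
  by (simp add: nat_pow_def)

lemma symplectic_p_groupD:
  assumes "symplectic_p_group p G"
  shows "symplectic_abelian_group G" "\<And>x. x \<in> carrier G \<Longrightarrow> \<exists>k. x [^]\<^bsub>G\<^esub> (p ^ k) = \<one>\<^bsub>G\<^esub>"
proof -
  show *: "symplectic_abelian_group G"
    using assms by (simp add: symplectic_p_group_def)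
  then interpret symplectic_abelian_group G .
  show "\<And>x. x \<in> carrier G \<Longrightarrow> \<exists>k. x [^]\<^bsub>G\<^esub> (p ^ k) = \<one>\<^bsub>G\<^esub>"
    using assms pow_order_eq_1 unfolding symplectic_p_group_def by metis
qed

section \<open>Orthogonality and nondegeneracy of the primary parts\<close>

context symplectic_abelian_group
begin

lemma pairing_closed [simp]:
  "x \<in> carrier G \<Longrightarrow> y \<in> carrier G \<Longrightarrow> pairing G x y \<in> carrier QZ"
  using hom_left[of y] by (auto simp: hom_def)

lemma pairing_one_left [simp]: "y \<in> carrier G \<Longrightarrow> pairing G \<one> y = \<one>\<^bsub>QZ\<^esub>"
  using hom_one[OF hom_left is_group QZ.is_group] .

lemma pairing_one_right [simp]: "x \<in> carrier G \<Longrightarrow> pairing G x \<one> = \<one>\<^bsub>QZ\<^esub>"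
  using hom_one[OF hom_right is_group QZ.is_group] .

text \<open>By bilinearity the value of the pairing is killed by \<open>m\<close> and by
  \<open>n\<close> in \<open>QZ\<close>.\<close>

lemma pairing_eq_one_if_coprime:
  assumes "x \<in> carrier G" "y \<in> carrier G" "x [^] (m::nat) = \<one>" "y [^] (n::nat) = \<one>" "coprime m n"
  shows "pairing G x y = \<one>\<^bsub>QZ\<^esub>"
proof (rule QZ.eq_one_if_coprime_powers)
  show "pairing G x y [^]\<^bsub>QZ\<^esub> m = \<one>\<^bsub>QZ\<^esub>"
    using hom_nat_pow[OF hom_left is_group QZ.is_group, of y x m] assms by simp
  show "pairing G x y [^]\<^bsub>QZ\<^esub> n = \<one>\<^bsub>QZ\<^esub>"
    using hom_nat_pow[OF hom_right is_group QZ.is_group, of x y n] assms by simp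
qed (use assms in auto)

lemma pairing_primary_parts:
  assumes "prime p" "prime q" "p \<noteq> q"
    and "x \<in> carrier (primary_part p G)" "y \<in> carrier (primary_part q G)"
  shows "pairing G x y = \<one>\<^bsub>QZ\<^esub>"
proof -
  obtain k l where "x [^] (p ^ k) = \<one>" "y [^] (q ^ l) = \<one>"
    using assms(4,5) by (auto simp: mem_primary_part)
  moreover have "coprime (p ^ k) (q ^ l)"
    using assms by (simp add: primes_coprime)
  ultimately show ?thesis
    using assms(4,5) by (intro pairing_eq_one_if_coprime) (auto simp: mem_primary_part)
qed

lemma pairing_finprod_left:
  assumes "f \<in> A \<rightarrow> carrier G" "y \<in> carrier G"
  shows "pairing G (finprod G f A) y = finprod QZ (\<lambda>i. pairing G (f i) y) A"
  by (rule hom_finprod[OF hom_left comm_group_axioms QZ.comm_group_axioms]) (use assms in auto)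

lemma pairing_finprod_right:
  assumes "f \<in> A \<rightarrow> carrier G" "x \<in> carrier G"
  shows "pairing G x (finprod G f A) = finprod QZ (\<lambda>i. pairing G x (f i)) A"
  by (rule hom_finprod[OF hom_right comm_group_axioms QZ.comm_group_axioms]) (use assms in auto)

lemma order_pos: "order G > 0"
  using finite_carrier by (simp add: order_gt_0_iff_finite)

lemma primary_decomposition:
  assumes "x \<in> carrier G"
  obtains y where "\<And>p. p \<in> prime_factors (order G) \<Longrightarrow> y p \<in> carrier (primary_part p G)"
    "x = finprod G y (prime_factors (order G))"
proof -
  have "x [^] order G = \<one>"
    using assms by (rule pow_order_eq_1)
  then obtain y where "y \<in> prime_factors (order G) \<rightarrow> carrier G"
    "\<And>p. p \<in> prime_factors (order G) \<Longrightarrow> \<exists>k. y p [^] (p ^ k) = \<one>"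
    "x = finprod G y (prime_factors (order G))"
    using prime_power_decomposition[of "prime_factors (order G)" "order G" x] order_pos assms
    by (auto simp: in_prime_factors_iff)
  then show ?thesis
    by (intro that) (auto simp: mem_primary_part)
qed

lemma subgroup_primary_part: "subgroup (carrier (primary_part p G)) G"
proof (rule subgroupI)
  show "carrier (primary_part p G) \<noteq> {}"
    using mem_primary_part[of \<one> p G] by auto
  show "inv a \<in> carrier (primary_part p G)" if "a \<in> carrier (primary_part p G)" for a
    using that by (auto simp: mem_primary_part nat_pow_inv)
  show "a \<otimes> b \<in> carrier (primary_part p G)"
    if ab: "a \<in> carrier (primary_part p G)" "b \<in> carrier (primary_part p G)" for a b
  proof -
    obtain k l where kl: "a \<in> carrier G" "b \<in> carrier G" "a [^] (p ^ k) = \<one>" "b [^] (p ^ l) = \<one>"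
      using ab by (auto simp: mem_primary_part)
    have "a [^] (p ^ (k + l)) = \<one>" "b [^] (p ^ (l + k)) = \<one>"
      using kl by (simp_all add: power_add flip: nat_pow_pow)
    then have "(a \<otimes> b) [^] (p ^ (k + l)) = \<one>"
      using kl by (simp add: nat_pow_distrib add.commute)
    then show ?thesis
      using kl by (auto simp: mem_primary_part)
  qed
qed (auto simp: mem_primary_part)

lemma primary_part_subset: "carrier (primary_part p G) \<subseteq> carrier G"
  by (auto simp: mem_primary_part)

lemma finite_primary_part: "finite (carrier (primary_part p G))"
  using primary_part_subset finite_carrier by (rule finite_subset)

lemma comm_group_primary_part: "comm_group (primary_part p G)"
proof (rule group.group_comm_groupI)
  have "primary_part p G = G\<lparr>carrier := carrier (primary_part p G)\<rparr>"
    by (simp add: primary_part_def)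
  then show "group (primary_part p G)"
    using subgroup.subgroup_is_group[OF subgroup_primary_part is_group] by metis
qed (auto simp: mem_primary_part m_comm)

text \<open>Every element of \<open>G\<close> is a product of primary components, and those at
  primes other than \<open>p\<close> are orthogonal to \<open>x\<close> anyway; so \<open>x\<close>
  is orthogonal to all of \<open>G\<close>.\<close>

lemma primary_part_nondegenerate:
  assumes "prime p" "x \<in> carrier (primary_part p G)"
    and "\<And>y. y \<in> carrier (primary_part p G) \<Longrightarrow> pairing G x y = \<one>\<^bsub>QZ\<^esub>"
  shows "x = \<one>"
proof (rule nondegenerate_left)
  show "x \<in> carrier G" using assms by (simp add: mem_primary_part)
  show "pairing G x z = \<one>\<^bsub>QZ\<^esub>" if "z \<in> carrier G" for z
  proof -
    obtain y where y: "\<And>q. q \<in> prime_factors (order G) \<Longrightarrow> y q \<in> carrier (primary_part q G)"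
      "z = finprod G y (prime_factors (order G))"
      using primary_decomposition[OF \<open>z \<in> carrier G\<close>] by blast
    have "pairing G x z = finprod QZ (\<lambda>q. pairing G x (y q)) (prime_factors (order G))"
      using y primary_part_subset \<open>x \<in> carrier G\<close> unfolding y(2) by (intro pairing_finprod_right) auto
    also have "\<dots> = \<one>\<^bsub>QZ\<^esub>"
    proof (rule QZ.finprod_one_eqI)
      fix q assume "q \<in> prime_factors (order G)"
      then show "pairing G x (y q) = \<one>\<^bsub>QZ\<^esub>"
        using assms y(1)[of q] pairing_primary_parts[of p q x "y q"]
        by (cases "q = p") (auto simp: in_prime_factors_iff)
    qed
    finally show ?thesis .
  qed
qed

text \<open>Expand the pairing of x + y with itself, in additive notation. This reduces right
  nondegeneracy of the primary parts to left nondegeneracy.\<close>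

lemma pairing_swap_eq_one:
  assumes "x \<in> carrier G" "y \<in> carrier G" "pairing G x y = \<one>\<^bsub>QZ\<^esub>"
  shows "pairing G y x = \<one>\<^bsub>QZ\<^esub>"
proof -
  have "\<one>\<^bsub>QZ\<^esub> = pairing G (x \<otimes> y) (x \<otimes> y)"
    using assms by (simp add: alternating)
  also have "\<dots> = pairing G x (x \<otimes> y) \<otimes>\<^bsub>QZ\<^esub> pairing G y (x \<otimes> y)"
    using assms hom_mult[OF hom_left[of "x \<otimes> y"]] by simp
  also have "\<dots> = pairing G y x"
    using assms hom_mult[OF hom_right[of x]] hom_mult[OF hom_right[of y]] by (simp add: alternating)
  finally show ?thesis by simp
qed

lemma symplectic_p_group_primary_part:
  assumes "prime p"
  shows "symplectic_p_group p (primary_part p G)"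
proof -
  interpret P: comm_group "primary_part p G"
    by (rule comm_group_primary_part)
  have carr: "x \<in> carrier G" if "x \<in> carrier (primary_part p G)" for x
    using that primary_part_subset by blast
  have "symplectic_abelian_group (primary_part p G)"
  proof
    show "x = \<one>\<^bsub>primary_part p G\<^esub>" if "x \<in> carrier (primary_part p G)"
      "\<And>y. y \<in> carrier (primary_part p G) \<Longrightarrow> pairing (primary_part p G) x y = \<one>\<^bsub>QZ\<^esub>" for x
      using primary_part_nondegenerate[OF assms] that by simp
    show "y = \<one>\<^bsub>primary_part p G\<^esub>" if "y \<in> carrier (primary_part p G)"
      "\<And>x. x \<in> carrier (primary_part p G) \<Longrightarrow> pairing (primary_part p G) x y = \<one>\<^bsub>QZ\<^esub>" for y
      using primary_part_nondegenerate[OF assms] pairing_swap_eq_one that carr by simp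
    show "(\<lambda>x. pairing (primary_part p G) x y) \<in> hom (primary_part p G) QZ"
      if "y \<in> carrier (primary_part p G)" for y
      using hom_left[OF carr[OF that]] carr by (auto simp: hom_def)
    show "pairing (primary_part p G) x \<in> hom (primary_part p G) QZ"
      if "x \<in> carrier (primary_part p G)" for x
      using hom_right[OF carr[OF that]] carr by (auto simp: hom_def)
  qed (auto simp: finite_primary_part alternating carr)
  moreover have "\<exists>k. order (primary_part p G) = p ^ k"
    by (rule P.order_eq_prime_power) (auto simp: finite_primary_part assms mem_primary_part)
  ultimately show ?thesis
    by (simp add: symplectic_p_group_def)
qed

text \<open>An element of the part is killed by a power of \<open>p\<close> and by
  \<open>order G\<close>, which are coprime.\<close>

lemma primary_part_eq_one:
  assumes "prime p" "p \<notin> prime_factors (order G)"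
  shows "carrier (primary_part p G) = {\<one>}"
proof -
  have "x = \<one>" if x: "x \<in> carrier (primary_part p G)" for x
  proof -
    obtain k where "x [^] (p ^ k) = \<one>" "x \<in> carrier G"
      using x by (auto simp: mem_primary_part)
    moreover have "coprime (p ^ k) (order G)"
      using assms order_pos by (simp add: in_prime_factors_iff prime_imp_coprime)
    ultimately show ?thesis
      using eq_one_if_coprime_powers pow_order_eq_1 by blast
  qed
  then show ?thesis
    by (auto simp: mem_primary_part)
qed

end

section \<open>Orthogonal direct sums\<close>

text \<open>The index set is arbitrary: all primes for the random group, and the finite set of prime
  divisors of the order when elements and automorphisms of one group are counted.\<close>

locale symplectic_family =
  fixes I :: "'i set" and T :: "'i \<Rightarrow> 'a pairing_group"
  assumes symplectic: "i \<in> I \<Longrightarrow> symplectic_abelian_group (T i)"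
begin

text \<open>The inclusion of the i-th summand. It is restricted to \<open>I\<close> because elements
  of the direct sum are extensional functions.\<close>

definition single :: "'i \<Rightarrow> 'a \<Rightarrow> 'i \<Rightarrow> 'a" where
  "single i a = (\<lambda>j\<in>I. if j = i then a else \<one>\<^bsub>T j\<^esub>)"

lemma group: "i \<in> I \<Longrightarrow> group (T i)"
  using symplectic by (auto simp: symplectic_abelian_group_def comm_group_def)

lemma comm: "i \<in> I \<Longrightarrow> comm_group (T i)"
  using symplectic by (auto simp: symplectic_abelian_group_def)

lemma carrier_direct_sum:
  "carrier (direct_sum I T) = {x \<in> \<Pi>\<^sub>E i\<in>I. carrier (T i). finite {i \<in> I. x i \<noteq> \<one>\<^bsub>T i\<^esub>}}"
  using group by (simp add: direct_sum_def monoid.extend_def carrier_sum_group)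

lemma direct_sum_simps [simp]:
  "\<one>\<^bsub>direct_sum I T\<^esub> = (\<lambda>i\<in>I. \<one>\<^bsub>T i\<^esub>)"
  "x \<otimes>\<^bsub>direct_sum I T\<^esub> y = (\<lambda>i\<in>I. x i \<otimes>\<^bsub>T i\<^esub> y i)"
  by (simp_all add: direct_sum_def monoid.extend_def)

lemma component_closed: "x \<in> carrier (direct_sum I T) \<Longrightarrow> i \<in> I \<Longrightarrow> x i \<in> carrier (T i)"
  by (auto simp: carrier_direct_sum PiE_iff)

lemma direct_sum_eqI:
  assumes "x \<in> carrier (direct_sum I T)" "y \<in> carrier (direct_sum I T)" "\<And>i. i \<in> I \<Longrightarrow> x i = y i"
  shows "x = y"
  using assms by (intro extensionalityI[of _ I]) (auto simp: carrier_direct_sum PiE_iff)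

lemma comm_group_direct_sum: "comm_group (direct_sum I T)"
proof -
  interpret S: group "sum_group I T"
    using group by (rule sum_group)
  have carr: "carrier (direct_sum I T) = carrier (sum_group I T)"
    by (simp add: direct_sum_def monoid.extend_def)
  show ?thesis
  proof (rule comm_groupI, unfold carr)
    show "x \<otimes>\<^bsub>direct_sum I T\<^esub> y = y \<otimes>\<^bsub>direct_sum I T\<^esub> x"
      if "x \<in> carrier (sum_group I T)" "y \<in> carrier (sum_group I T)" for x y
      using that component_closed[unfolded carr] comm
      by (auto intro!: restrict_ext comm_monoid.m_comm simp: comm_group_def)
  qed (use S.m_closed S.one_closed S.m_assoc S.l_one S.l_inv_ex in auto)
qed

lemma single_in_carrier: "i \<in> I \<Longrightarrow> a \<in> carrier (T i) \<Longrightarrow> single i a \<in> carrier (direct_sum I T)"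
  using group
  by (auto simp: carrier_direct_sum single_def group.is_monoid
      intro: finite_subset[of _ "{i}"])

lemma single_hom:
  assumes "i \<in> I"
  shows "single i \<in> hom (T i) (direct_sum I T)"
proof (rule homI)
  show "single i (x \<otimes>\<^bsub>T i\<^esub> y) = single i x \<otimes>\<^bsub>direct_sum I T\<^esub> single i y" for x y
    using group by (auto simp: single_def group.is_monoid)
qed (rule single_in_carrier[OF assms])

lemma component_hom: "i \<in> I \<Longrightarrow> (\<lambda>x. x i) \<in> hom (direct_sum I T) (T i)"
  by (auto simp: hom_def component_closed)

lemma pairing_one_component:
  assumes "i \<in> I" "a \<in> carrier (T i)"
  shows "pairing (T i) \<one>\<^bsub>T i\<^esub> a = \<one>\<^bsub>QZ\<^esub>" "pairing (T i) a \<one>\<^bsub>T i\<^esub> = \<one>\<^bsub>QZ\<^esub>"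
  using symplectic_abelian_group.pairing_one_left[OF symplectic]
    symplectic_abelian_group.pairing_one_right[OF symplectic] assms by auto

text \<open>The definition sums over the support of \<open>x\<close>. Indices with trivial
  contribution may be added or dropped, so any finite \<open>S\<close> containing all other indices
  will do; this allows a common index set for several elements and puts \<open>x\<close> and
  \<open>y\<close> on the same footing.\<close>

lemma pairing_direct_sum:
  assumes x: "x \<in> carrier (direct_sum I T)" and y: "y \<in> carrier (direct_sum I T)"
    and S: "finite S" "S \<subseteq> I" "\<And>i. i \<in> I - S \<Longrightarrow> pairing (T i) (x i) (y i) = \<one>\<^bsub>QZ\<^esub>"
  shows "pairing (direct_sum I T) x y = finprod QZ (\<lambda>i. pairing (T i) (x i) (y i)) S"
proof -
  have closed: "pairing (T i) (x i) (y i) \<in> carrier QZ" if "i \<in> I" for i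
    using that x y symplectic symplectic_abelian_group.pairing_closed component_closed by metis
  have "pairing (direct_sum I T) x y =
      finprod QZ (\<lambda>i. pairing (T i) (x i) (y i)) {i \<in> I. x i \<noteq> \<one>\<^bsub>T i\<^esub>}"
    by (simp add: direct_sum_def monoid.extend_def pairing_group.defs)
  also have "\<dots> = finprod QZ (\<lambda>i. pairing (T i) (x i) (y i)) S"
    using x S closed component_closed[OF y]
    by (intro QZ.finprod_mono_neutral_cong) (auto simp: carrier_direct_sum pairing_one_component)
  finally show ?thesis .
qed

lemma pairing_single_right:
  assumes "x \<in> carrier (direct_sum I T)" "i \<in> I" "a \<in> carrier (T i)"
  shows "pairing (direct_sum I T) x (single i a) = pairing (T i) (x i) a"
proof -
  have "pairing (T i) (x i) a \<in> carrier QZ"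
    using symplectic_abelian_group.pairing_closed[OF symplectic] component_closed assms by metis
  moreover have "pairing (direct_sum I T) x (single i a) =
      finprod QZ (\<lambda>j. pairing (T j) (x j) (single i a j)) {i}"
    using assms component_closed[OF assms(1)]
    by (intro pairing_direct_sum single_in_carrier) (auto simp: pairing_one_component single_def)
  ultimately show ?thesis
    using assms by (simp add: single_def)
qed

lemma pairing_single_left:
  assumes "x \<in> carrier (direct_sum I T)" "i \<in> I" "a \<in> carrier (T i)"
  shows "pairing (direct_sum I T) (single i a) x = pairing (T i) a (x i)"
proof -
  have "pairing (T i) a (x i) \<in> carrier QZ"
    using symplectic_abelian_group.pairing_closed[OF symplectic] component_closed assms by metis
  moreover have "pairing (direct_sum I T) (single i a) x =
      finprod QZ (\<lambda>j. pairing (T j) (single i a j) (x j)) {i}"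
    using assms component_closed[OF assms(1)]
    by (intro pairing_direct_sum single_in_carrier) (auto simp: pairing_one_component single_def)
  ultimately show ?thesis
    using assms by (simp add: single_def)
qed

text \<open>Bilinearity and alternation hold termwise once the sums run over a common finite set.
  Nondegeneracy is tested against the elements \<open>single i a\<close>, which isolate one
  component.\<close>

lemma symplectic_direct_sum:
  assumes "finite (carrier (direct_sum I T))"
  shows "symplectic_abelian_group (direct_sum I T)"
proof -
  let ?D = "direct_sum I T"
  let ?supp = "\<lambda>x. {i \<in> I. x i \<noteq> \<one>\<^bsub>T i\<^esub>}"
  interpret D: comm_group ?D
    by (rule comm_group_direct_sum)
  have fin: "finite (?supp x)" if "x \<in> carrier ?D" for x
    using that by (simp add: carrier_direct_sum)
  have closed: "pairing (T i) (x i) (y i) \<in> carrier QZ"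
    if "i \<in> I" "x \<in> carrier ?D" "y \<in> carrier ?D" for i x y
    using that symplectic symplectic_abelian_group.pairing_closed component_closed by metis
  have off: "pairing (T i) (x i) (y i) = \<one>\<^bsub>QZ\<^esub>"
    if "i \<in> I" "i \<notin> ?supp x" "y \<in> carrier ?D" for i x y
    using that component_closed by (auto simp: pairing_one_component)
  have pair: "pairing ?D x y = finprod QZ (\<lambda>i. pairing (T i) (x i) (y i)) S"
    if "x \<in> carrier ?D" "y \<in> carrier ?D" "finite S" "?supp x \<subseteq> S" "S \<subseteq> I" for x y S
    using that off by (intro pairing_direct_sum) auto
  have pair_closed: "pairing ?D x y \<in> carrier QZ" if "x \<in> carrier ?D" "y \<in> carrier ?D" for x y
    using that fin closed by (subst pair[of x y "?supp x"]) (auto intro!: QZ.finprod_closed)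
  show ?thesis
  proof
    show "finite (carrier ?D)" by fact
    show "(\<lambda>x. pairing ?D x y) \<in> hom ?D QZ" if y: "y \<in> carrier ?D" for y
    proof (rule homI)
      fix x x' assume xx: "x \<in> carrier ?D" "x' \<in> carrier ?D"
      \<comment> \<open>In the first argument three supports occur, all contained in this union. In
        the second argument the support of the fixed \<open>x\<close> suffices.\<close>
      let ?S = "?supp x \<union> ?supp x'"
      have S: "finite ?S" "?supp x \<subseteq> ?S" "?supp x' \<subseteq> ?S" "?S \<subseteq> I"
        using fin xx by auto
      have supp: "?supp (x \<otimes>\<^bsub>?D\<^esub> x') \<subseteq> ?S"
        using group by (auto simp: group.is_monoid)
      have "pairing ?D (x \<otimes>\<^bsub>?D\<^esub> x') y = finprod QZ (\<lambda>i. pairing (T i) ((x \<otimes>\<^bsub>?D\<^esub> x') i) (y i)) ?S"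
        using xx y S supp by (intro pair) (auto simp del: direct_sum_simps)
      also have "\<dots> = finprod QZ (\<lambda>i. pairing (T i) (x i) (y i) \<otimes>\<^bsub>QZ\<^esub> pairing (T i) (x' i) (y i)) ?S"
      proof (rule QZ.finprod_cong')
        fix i assume "i \<in> ?S"
        then show "pairing (T i) ((x \<otimes>\<^bsub>?D\<^esub> x') i) (y i) =
            pairing (T i) (x i) (y i) \<otimes>\<^bsub>QZ\<^esub> pairing (T i) (x' i) (y i)"
          using xx y component_closed
            hom_mult[OF symplectic_abelian_group.hom_left[OF symplectic, of i "y i"]] by auto
      qed (use xx y closed in auto)
      also have "\<dots> = finprod QZ (\<lambda>i. pairing (T i) (x i) (y i)) ?S \<otimes>\<^bsub>QZ\<^esub>
          finprod QZ (\<lambda>i. pairing (T i) (x' i) (y i)) ?S"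
        using xx y closed by (intro QZ.finprod_multf) auto
      also have "\<dots> = pairing ?D x y \<otimes>\<^bsub>QZ\<^esub> pairing ?D x' y"
        by (simp only: pair[OF xx(1) y S(1,2,4)] pair[OF xx(2) y S(1,3,4)])
      finally show "pairing ?D (x \<otimes>\<^bsub>?D\<^esub> x') y = pairing ?D x y \<otimes>\<^bsub>QZ\<^esub> pairing ?D x' y" .
    qed (use y pair_closed in auto)
    show "pairing ?D x \<in> hom ?D QZ" if x: "x \<in> carrier ?D" for x
    proof (rule homI)
      fix y y' assume yy: "y \<in> carrier ?D" "y' \<in> carrier ?D"
      let ?S = "?supp x"
      have "pairing ?D x (y \<otimes>\<^bsub>?D\<^esub> y') = finprod QZ (\<lambda>i. pairing (T i) (x i) ((y \<otimes>\<^bsub>?D\<^esub> y') i)) ?S"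
        using x yy fin by (intro pair) (auto simp del: direct_sum_simps)
      also have "\<dots> = finprod QZ (\<lambda>i. pairing (T i) (x i) (y i) \<otimes>\<^bsub>QZ\<^esub> pairing (T i) (x i) (y' i)) ?S"
      proof (rule QZ.finprod_cong')
        fix i assume "i \<in> ?S"
        then show "pairing (T i) (x i) ((y \<otimes>\<^bsub>?D\<^esub> y') i) =
            pairing (T i) (x i) (y i) \<otimes>\<^bsub>QZ\<^esub> pairing (T i) (x i) (y' i)"
          using x yy component_closed
            hom_mult[OF symplectic_abelian_group.hom_right[OF symplectic, of i "x i"]] by auto
      qed (use x yy closed in auto)
      also have "\<dots> = pairing ?D x y \<otimes>\<^bsub>QZ\<^esub> pairing ?D x y'"
        using x yy fin[OF x] closed by (simp add: pair[of x y ?S] pair[of x y' ?S] Pi_iff)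
      finally show "pairing ?D x (y \<otimes>\<^bsub>?D\<^esub> y') = pairing ?D x y \<otimes>\<^bsub>QZ\<^esub> pairing ?D x y'" .
    qed (use x pair_closed in auto)
    show "pairing ?D x x = \<one>\<^bsub>QZ\<^esub>" if "x \<in> carrier ?D" for x
      using that fin[OF that] component_closed
      by (subst pair[of x x "?supp x"])
        (auto intro!: QZ.finprod_one_eqI symplectic_abelian_group.alternating symplectic)
    show "x = \<one>\<^bsub>?D\<^esub>" if x: "x \<in> carrier ?D"
      and orth: "\<And>y. y \<in> carrier ?D \<Longrightarrow> pairing ?D x y = \<one>\<^bsub>QZ\<^esub>" for x
    proof (rule direct_sum_eqI)
      fix i assume i: "i \<in> I"
      have "pairing (T i) (x i) a = \<one>\<^bsub>QZ\<^esub>" if "a \<in> carrier (T i)" for a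
        using orth[OF single_in_carrier[OF i that]] pairing_single_right[OF x i that] by simp
      then show "x i = \<one>\<^bsub>?D\<^esub> i"
        using symplectic_abelian_group.nondegenerate_left[OF symplectic] component_closed x i by auto
    qed (use x D.one_closed in auto)
    show "x = \<one>\<^bsub>?D\<^esub>" if x: "x \<in> carrier ?D"
      and orth: "\<And>y. y \<in> carrier ?D \<Longrightarrow> pairing ?D y x = \<one>\<^bsub>QZ\<^esub>" for x
    proof (rule direct_sum_eqI)
      fix i assume i: "i \<in> I"
      have "pairing (T i) a (x i) = \<one>\<^bsub>QZ\<^esub>" if "a \<in> carrier (T i)" for a
        using orth[OF single_in_carrier[OF i that]] pairing_single_left[OF x i that] by simp
      then show "x i = \<one>\<^bsub>?D\<^esub> i"
        using symplectic_abelian_group.nondegenerate_right[OF symplectic] component_closed x i by auto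
    qed (use x D.one_closed in auto)
  qed
qed

text \<open>Restriction to the nontrivial summands is injective, since the other components are
  forced, and it lands in a finite product of finite sets.\<close>

lemma finite_direct_sum:
  assumes "finite {i \<in> I. carrier (T i) \<noteq> {\<one>\<^bsub>T i\<^esub>}}"
  shows "finite (carrier (direct_sum I T))"
proof -
  let ?J = "{i \<in> I. carrier (T i) \<noteq> {\<one>\<^bsub>T i\<^esub>}}"
  have "finite (\<Pi>\<^sub>E i\<in>?J. carrier (T i))"
    using assms symplectic_abelian_group.finite_carrier[OF symplectic] by (intro finite_PiE) auto
  moreover have "(\<lambda>x. restrict x ?J) ` carrier (direct_sum I T) \<subseteq> (\<Pi>\<^sub>E i\<in>?J. carrier (T i))"
  proof (rule image_subsetI)
    fix x assume x: "x \<in> carrier (direct_sum I T)"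
    show "restrict x ?J \<in> (\<Pi>\<^sub>E i\<in>?J. carrier (T i))"
      using component_closed[OF x] by (simp add: restrict_PiE_iff)
  qed
  moreover have "inj_on (\<lambda>x. restrict x ?J) (carrier (direct_sum I T))"
  proof (rule inj_onI, rule direct_sum_eqI)
    fix x y i assume *: "x \<in> carrier (direct_sum I T)" "y \<in> carrier (direct_sum I T)"
      "restrict x ?J = restrict y ?J" "i \<in> I"
    show "x i = y i"
    proof (cases "i \<in> ?J")
      case True
      then show ?thesis using fun_cong[OF *(3), of i] by (simp add: restrict_def)
    next
      case False
      then show ?thesis
        using component_closed[OF *(1,4)] component_closed[OF *(2,4)] *(4) by auto
    qed
  qed
  ultimately show ?thesis
    using inj_on_finite by blast
qed

end

section \<open>Direct sums of primary components\<close>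

text \<open>The maps \<open>f p\<close> are kept as a parameter because they are chosen in three
  ways later: given isomorphisms, identities of the primary parts, and arbitrary symplectic
  automorphisms of these parts.\<close>

locale primary_family = symplectic_family I T + G: symplectic_abelian_group G
  for I :: "nat set" and T :: "nat \<Rightarrow> 'a pairing_group" and G :: "'b pairing_group" +
  fixes f :: "nat \<Rightarrow> 'a \<Rightarrow> 'b"
  assumes prime: "p \<in> I \<Longrightarrow> prime p"
    and prime_factors_subset: "prime_factors (order G) \<subseteq> I"
    and iso: "p \<in> I \<Longrightarrow> f p \<in> iso (T p) (primary_part p G)"
    and pres: "p \<in> I \<Longrightarrow> preserves_pairing (T p) (primary_part p G) (f p)"
begin

text \<open>The index set is finite, as \<open>finprod\<close> demands, and independent of
  \<open>x\<close>, so that multiplicativity is immediate. The components left out are trivial by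
  \<open>trivial_component\<close>.\<close>

definition assemble :: "(nat \<Rightarrow> 'a) \<Rightarrow> 'b" where
  "assemble x = finprod G (\<lambda>p. f p (x p)) (prime_factors (order G))"

lemma f_hom: "p \<in> I \<Longrightarrow> f p \<in> hom (T p) (primary_part p G)"
  using iso by (auto simp: iso_def)

lemma f_closed: "p \<in> I \<Longrightarrow> a \<in> carrier (T p) \<Longrightarrow> f p a \<in> carrier (primary_part p G)"
  using f_hom by (auto simp: hom_def)

lemma f_closed': "p \<in> I \<Longrightarrow> a \<in> carrier (T p) \<Longrightarrow> f p a \<in> carrier G"
  using f_closed G.primary_part_subset by blast

lemma f_one: "p \<in> I \<Longrightarrow> f p \<one>\<^bsub>T p\<^esub> = \<one>\<^bsub>G\<^esub>"
  using hom_one[OF f_hom group] G.comm_group_primary_part by (simp add: comm_group_def)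

lemma trivial_component:
  assumes "p \<in> I" "p \<notin> prime_factors (order G)" "a \<in> carrier (T p)"
  shows "a = \<one>\<^bsub>T p\<^esub>"
proof -
  have "f p a = f p \<one>\<^bsub>T p\<^esub>"
    using f_closed[OF assms(1,3)] G.primary_part_eq_one[OF prime[OF assms(1)] assms(2)] f_one[OF assms(1)]
    by simp
  moreover have "inj_on (f p) (carrier (T p))"
    using iso[OF assms(1)] by (simp add: iso_def bij_betw_def)
  ultimately show ?thesis
    using assms group group.is_monoid monoid.one_closed by (metis inj_onD)
qed

lemma assemble_family:
  assumes "x \<in> carrier (direct_sum I T)"
  shows "(\<lambda>p. f p (x p)) \<in> prime_factors (order G) \<rightarrow> carrier G"
proof (rule Pi_I)
  fix p assume "p \<in> prime_factors (order G)"
  then have "p \<in> I" using prime_factors_subset by blast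
  then show "f p (x p) \<in> carrier G"
    by (intro f_closed' component_closed[OF assms])
qed

lemma assemble_hom: "assemble \<in> hom (direct_sum I T) G"
proof (rule homI)
  show "assemble x \<in> carrier G" if "x \<in> carrier (direct_sum I T)" for x
    using assemble_family[OF that] by (simp add: assemble_def)
  fix x y assume xy: "x \<in> carrier (direct_sum I T)" "y \<in> carrier (direct_sum I T)"
  have "assemble (x \<otimes>\<^bsub>direct_sum I T\<^esub> y) =
      finprod G (\<lambda>p. f p (x p) \<otimes>\<^bsub>G\<^esub> f p (y p)) (prime_factors (order G))"
    unfolding assemble_def
  proof (rule G.finprod_cong')
    fix p assume "p \<in> prime_factors (order G)"
    then have p: "p \<in> I" using prime_factors_subset by blast
    then show "f p ((x \<otimes>\<^bsub>direct_sum I T\<^esub> y) p) = f p (x p) \<otimes>\<^bsub>G\<^esub> f p (y p)"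
      using hom_mult[OF f_hom[OF p] component_closed[OF xy(1) p] component_closed[OF xy(2) p]] by simp
  qed (use assemble_family[OF xy(1)] assemble_family[OF xy(2)] in auto)
  also have "\<dots> = assemble x \<otimes>\<^bsub>G\<^esub> assemble y"
    unfolding assemble_def
    by (rule G.finprod_multf[OF assemble_family[OF xy(1)] assemble_family[OF xy(2)]])
  finally show "assemble (x \<otimes>\<^bsub>direct_sum I T\<^esub> y) = assemble x \<otimes>\<^bsub>G\<^esub> assemble y" .
qed

text \<open>Bilinearity turns the left side into a double sum over primes p and q. Distinct primary
  parts are orthogonal, so only the diagonal survives, where \<open>f p\<close> preserves the
  pairing.\<close>

lemma assemble_pairing:
  assumes x: "x \<in> carrier (direct_sum I T)" and y: "y \<in> carrier (direct_sum I T)"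
  shows "pairing G (assemble x) (assemble y) = pairing (direct_sum I T) x y"
proof -
  let ?S = "prime_factors (order G)"
  have I: "p \<in> I" if "p \<in> ?S" for p
    using that prime_factors_subset by blast
  have "assemble y \<in> carrier G"
    using assemble_family[OF y] by (simp add: assemble_def)
  then have "pairing G (assemble x) (assemble y) = finprod QZ (\<lambda>p. pairing G (f p (x p)) (assemble y)) ?S"
    unfolding assemble_def[of x] using assemble_family[OF x] by (intro G.pairing_finprod_left)
  also have "\<dots> = finprod QZ (\<lambda>p. pairing (T p) (x p) (y p)) ?S"
  proof (rule QZ.finprod_cong')
    show "(\<lambda>p. pairing (T p) (x p) (y p)) \<in> ?S \<rightarrow> carrier QZ"
      using symplectic_abelian_group.pairing_closed[OF symplectic] component_closed x y I
      by (intro Pi_I) metis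
    fix p assume p: "p \<in> ?S"
    have pI: "p \<in> I" using I[OF p] .
    have fx: "f p (x p) \<in> carrier (primary_part p G)"
      using f_closed[OF pI component_closed[OF x pI]] .
    then have fx': "f p (x p) \<in> carrier G"
      using G.primary_part_subset by blast
    have fy: "f q (y q) \<in> carrier (primary_part q G)" if "q \<in> ?S" for q
      using f_closed[OF I[OF that] component_closed[OF y I[OF that]]] .
    have "pairing G (f p (x p)) (assemble y) = finprod QZ (\<lambda>q. pairing G (f p (x p)) (f q (y q))) ?S"
      unfolding assemble_def using assemble_family[OF y] fx' by (rule G.pairing_finprod_right)
    also have "\<dots> = finprod QZ (\<lambda>q. if q = p then pairing G (f p (x p)) (f q (y q)) else \<one>\<^bsub>QZ\<^esub>) ?S"
      using fx fx' fy G.pairing_primary_parts[OF prime[OF pI] prime[OF I]] assemble_family[OF y]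
      by (intro QZ.finprod_cong') (auto simp: Pi_iff)
    also have "\<dots> = pairing G (f p (x p)) (f p (y p))"
      using p fx' assemble_family[OF y] by (intro QZ.finprod_singleton_swap) (auto simp: Pi_iff)
    also have "\<dots> = pairing (T p) (x p) (y p)"
      using pres[OF pI] component_closed[OF x pI] component_closed[OF y pI]
      by (simp add: preserves_pairing_def)
    finally show "pairing G (f p (x p)) (assemble y) = pairing (T p) (x p) (y p)" .
  qed simp
  \<comment> \<open>Indices in \<open>I\<close> outside the prime divisors of the order carry
    trivial components and contribute nothing.\<close>
  also have "\<dots> = pairing (direct_sum I T) x y"
  proof (rule pairing_direct_sum[OF x y, symmetric])
    fix p assume p: "p \<in> I - ?S"
    then show "pairing (T p) (x p) (y p) = \<one>\<^bsub>QZ\<^esub>"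
      using trivial_component[OF _ _ component_closed[OF x]] component_closed[OF y]
      by (simp add: pairing_one_component)
  qed (use prime_factors_subset in auto)
  finally show ?thesis .
qed

lemma assemble_single:
  assumes "p \<in> I" "a \<in> carrier (T p)"
  shows "assemble (single p a) = f p a"
proof (cases "p \<in> prime_factors (order G)")
  case True
  have "assemble (single p a) = finprod G (\<lambda>q. if q = p then f p a else \<one>\<^bsub>G\<^esub>) (prime_factors (order G))"
    unfolding assemble_def
    using prime_factors_subset f_closed'[OF assms]
    by (intro G.finprod_cong') (auto simp: single_def f_one subset_iff)
  also have "\<dots> = f p a"
    using True f_closed'[OF assms] by (intro G.finprod_singleton_swap) auto
  finally show ?thesis .
next
  case False
  then have "a = \<one>\<^bsub>T p\<^esub>"
    using trivial_component assms by blast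
  then show ?thesis
    using assms(1) prime_factors_subset unfolding assemble_def
    by (auto intro!: G.finprod_one_eqI simp: single_def f_one subset_iff)
qed

text \<open>Injectivity is forced by the nondegeneracy of the pairings on the components.\<close>

lemma assemble_iso: "assemble \<in> iso (direct_sum I T) G"
proof -
  let ?D = "direct_sum I T" and ?S = "prime_factors (order G)"
  interpret D: comm_group ?D
    by (rule comm_group_direct_sum)
  have "x = \<one>\<^bsub>?D\<^esub>" if x: "x \<in> carrier ?D" and ker: "assemble x = \<one>\<^bsub>G\<^esub>" for x
  proof (rule direct_sum_eqI)
    fix p assume p: "p \<in> I"
    \<comment> \<open>This value is the pairing of \<open>assemble x\<close>, which is trivial, with
      \<open>f p a\<close>.\<close>
    have "pairing (T p) (x p) a = \<one>\<^bsub>QZ\<^esub>" if a: "a \<in> carrier (T p)" for a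
      using assemble_pairing[OF x single_in_carrier[OF p a]] pairing_single_right[OF x p a] ker
      by (simp add: assemble_single[OF p a] f_closed'[OF p a])
    then show "x p = \<one>\<^bsub>?D\<^esub> p"
      using symplectic_abelian_group.nondegenerate_left[OF symplectic[OF p]] component_closed[OF x p] p
      by auto
  qed (use x D.one_closed in auto)
  then have "assemble \<in> mon ?D G"
    using mon_iff_hom_one[OF D.is_group G.is_group] assemble_hom by blast
  moreover have "z \<in> assemble ` carrier ?D" if "z \<in> carrier G" for z
  proof -
    obtain y where y: "\<And>p. p \<in> ?S \<Longrightarrow> y p \<in> carrier (primary_part p G)" "z = finprod G y ?S"
      using G.primary_decomposition[OF \<open>z \<in> carrier G\<close>] by blast
    have "\<exists>a. a \<in> carrier (T p) \<and> f p a = y p" if "p \<in> ?S" for p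
    proof -
      have "f p ` carrier (T p) = carrier (primary_part p G)"
        using iso[of p] that prime_factors_subset by (auto simp: iso_def bij_betw_def)
      then show ?thesis
        using y(1)[OF that] by (metis imageE)
    qed
    then obtain a where a: "\<And>p. p \<in> ?S \<Longrightarrow> a p \<in> carrier (T p)" "\<And>p. p \<in> ?S \<Longrightarrow> f p (a p) = y p"
      by metis
    define x where "x = (\<lambda>p\<in>I. if p \<in> ?S then a p else \<one>\<^bsub>T p\<^esub>)"
    have "x \<in> carrier ?D"
      using a monoid.one_closed[OF group.is_monoid[OF group]]
      by (auto simp: carrier_direct_sum x_def intro: finite_subset[of _ ?S])
    moreover have "assemble x = z"
      unfolding y(2) assemble_def
    proof (rule G.finprod_cong')
      show "y \<in> ?S \<rightarrow> carrier G"
        using y(1) G.primary_part_subset by blast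
    qed (use a prime_factors_subset in \<open>auto simp: x_def subset_iff\<close>)
    ultimately show ?thesis by blast
  qed
  then have "assemble \<in> epi ?D G"
    using assemble_hom by (auto simp: epi_def hom_def)
  ultimately show ?thesis
    by (simp add: iso_iff_mon_epi)
qed

lemma direct_sum_isomorphic: "direct_sum I T \<simeq>\<^sub>s G"
  using assemble_iso assemble_pairing
  by (intro symplectic_isomorphicI[of assemble]) (auto simp: preserves_pairing_def)

end

lemma direct_sum_isomorphicI:
  assumes "symplectic_abelian_group G" "prime_factors (order G) \<subseteq> I"
    and "\<And>p. p \<in> I \<Longrightarrow> prime p" "\<And>p. p \<in> I \<Longrightarrow> symplectic_abelian_group (T p)"
    and "\<And>p. p \<in> I \<Longrightarrow> T p \<simeq>\<^sub>s primary_part p G"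
  shows "direct_sum I T \<simeq>\<^sub>s G"
proof -
  obtain f where f: "\<And>p. p \<in> I \<Longrightarrow> f p \<in> iso (T p) (primary_part p G)"
    "\<And>p. p \<in> I \<Longrightarrow> preserves_pairing (T p) (primary_part p G) (f p)"
    using assms(5) unfolding symplectic_isomorphic_def by metis
  interpret G: symplectic_abelian_group G by fact
  interpret primary_family I T G f
    using assms f
    by (intro primary_family.intro symplectic_family.intro primary_family_axioms.intro) auto
  show ?thesis by (rule direct_sum_isomorphic)
qed

text \<open>The isomorphism is \<open>h\<close> after the inclusion \<open>single p\<close>. The
  point is surjectivity onto the p-part: an element killed by p^k has a preimage killed by p^k, and
  such a preimage is concentrated in the summand at \<open>p\<close>.\<close>

lemma component_isomorphic_primary_part:
  assumes G: "symplectic_abelian_group G" and iso: "direct_sum I T \<simeq>\<^sub>s G"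
    and prime: "\<And>p. p \<in> I \<Longrightarrow> prime p" and T: "\<And>p. p \<in> I \<Longrightarrow> symplectic_p_group p (T p)"
    and p: "p \<in> I"
  shows "T p \<simeq>\<^sub>s primary_part p G"
proof -
  interpret G: symplectic_abelian_group G by fact
  interpret symplectic_family I T
    by (rule symplectic_family.intro) (rule symplectic_p_groupD(1)[OF T])
  let ?D = "direct_sum I T"
  interpret D: comm_group ?D
    by (rule comm_group_direct_sum)
  obtain h where h: "h \<in> iso ?D G" "preserves_pairing ?D G h"
    using iso by (rule symplectic_isomorphicE)
  have h_hom: "h \<in> hom ?D G" and h_inj: "inj_on h (carrier ?D)" and h_surj: "h ` carrier ?D = carrier G"
    using h by (auto simp: iso_def bij_betw_def)
  define g where "g a = h (single p a)" for a
  have "h \<circ> single p \<in> hom (T p) G"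
    using single_hom[OF p] h_hom by (rule hom_compose)
  then have g_hom: "g \<in> hom (T p) G"
    by (simp add: g_def[abs_def] comp_def)
  have closed: "g a \<in> carrier (primary_part p G)" if a: "a \<in> carrier (T p)" for a
  proof -
    obtain k where "a [^]\<^bsub>T p\<^esub> (p ^ k) = \<one>\<^bsub>T p\<^esub>"
      using symplectic_p_groupD(2)[OF T[OF p] a] by blast
    then have "g a [^]\<^bsub>G\<^esub> (p ^ k) = \<one>\<^bsub>G\<^esub>"
      using hom_nat_pow[OF g_hom group[OF p] G.is_group a, of "p ^ k"]
        hom_one[OF g_hom group[OF p] G.is_group] by simp
    then show ?thesis
      using g_hom a by (auto simp: mem_primary_part hom_def)
  qed
  have "g \<in> hom (T p) (primary_part p G)"
    using g_hom closed by (auto simp: hom_def)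
  moreover have "inj_on g (carrier (T p))"
  proof (rule inj_onI)
    fix a b assume ab: "a \<in> carrier (T p)" "b \<in> carrier (T p)" "g a = g b"
    then have "single p a = single p b"
      using inj_onD[OF h_inj] single_in_carrier[OF p] by (simp add: g_def)
    then show "a = b"
      using p by (auto simp: single_def dest: fun_cong[of _ _ p])
  qed
  moreover have "z \<in> g ` carrier (T p)" if z: "z \<in> carrier (primary_part p G)" for z
  proof -
    obtain k where k: "z \<in> carrier G" "z [^]\<^bsub>G\<^esub> (p ^ k) = \<one>\<^bsub>G\<^esub>"
      using z by (auto simp: mem_primary_part)
    then obtain x where x: "x \<in> carrier ?D" "h x = z"
      using h_surj by (metis imageE)
    have "h (x [^]\<^bsub>?D\<^esub> (p ^ k)) = h \<one>\<^bsub>?D\<^esub>"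
      using hom_nat_pow[OF h_hom D.is_group G.is_group x(1)] hom_one[OF h_hom D.is_group G.is_group]
        x k by simp
    then have xp: "x [^]\<^bsub>?D\<^esub> (p ^ k) = \<one>\<^bsub>?D\<^esub>"
      using inj_onD[OF h_inj] x(1) D.one_closed D.nat_pow_closed by blast
    have "x q = single p (x p) q" if q: "q \<in> I" for q
    proof (cases "q = p")
      case False
      \<comment> \<open>Since \<open>T q\<close> is a q-group, the component at q is killed by a
        power of q as well as by p^k, hence trivial.\<close>
      obtain l where l: "x q [^]\<^bsub>T q\<^esub> (q ^ l) = \<one>\<^bsub>T q\<^esub>"
        using symplectic_p_groupD(2)[OF T[OF q] component_closed[OF x(1) q]] by blast
      have "x q [^]\<^bsub>T q\<^esub> (p ^ k) = \<one>\<^bsub>T q\<^esub>"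
        using hom_nat_pow[OF component_hom[OF q] D.is_group group[OF q] x(1), of "p ^ k"] xp q by simp
      moreover have "coprime (p ^ k) (q ^ l)"
        using False prime[OF p] prime[OF q] by (simp add: primes_coprime)
      ultimately have "x q = \<one>\<^bsub>T q\<^esub>"
        using group.eq_one_if_coprime_powers[OF group[OF q] component_closed[OF x(1) q]] l by blast
      then show ?thesis
        using False q by (simp add: single_def)
    qed (use p in \<open>simp add: single_def\<close>)
    then have "x = single p (x p)"
      by (intro direct_sum_eqI[OF x(1) single_in_carrier[OF p component_closed[OF x(1) p]]])
    then have "z = g (x p)"
      using x(2) by (simp add: g_def)
    then show ?thesis
      using component_closed[OF x(1) p] by blast
  qed
  ultimately have "g \<in> iso (T p) (primary_part p G)"
    using closed by (auto simp: iso_def bij_betw_def)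
  moreover have "preserves_pairing (T p) (primary_part p G) g"
    unfolding preserves_pairing_def
  proof (intro ballI)
    fix a b assume ab: "a \<in> carrier (T p)" "b \<in> carrier (T p)"
    have "pairing G (g a) (g b) = pairing ?D (single p a) (single p b)"
      using h(2) single_in_carrier[OF p] ab by (simp add: preserves_pairing_def g_def)
    also have "\<dots> = pairing (T p) a b"
      using pairing_single_right[OF single_in_carrier[OF p] p] ab p by (simp add: single_def)
    finally show "pairing (primary_part p G) (g a) (g b) = pairing (T p) a b"
      by simp
  qed
  ultimately show ?thesis
    by (rule symplectic_isomorphicI)
qed

section \<open>Symplectic automorphisms\<close>

lemma Sp_iff:
  "f \<in> Sp G \<longleftrightarrow> f \<in> iso G G \<and> f \<in> extensional (carrier G) \<and> preserves_pairing G G f"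
  by (auto simp: Sp_def auto_def Bij_def iso_def)

text \<open>Members of \<open>auto G\<close> are extensional, so that each automorphism is counted
  once; maps built by composition must therefore be cut down to the carrier.\<close>

lemma restrict_in_Sp:
  assumes "group G" "f \<in> iso G G" "preserves_pairing G G f"
  shows "restrict f (carrier G) \<in> Sp G"
  using assms group.iso_eq[OF assms(1,2), of "restrict f (carrier G)"]
  by (simp add: Sp_iff preserves_pairing_def)

lemma conjugate_in_Sp:
  assumes "group H" and h: "h \<in> iso G H" "preserves_pairing G H h"
    and k: "k \<in> iso H G" "preserves_pairing H G k" and f: "f \<in> Sp G"
  shows "restrict (h \<circ> f \<circ> k) (carrier H) \<in> Sp H"
proof (rule restrict_in_Sp)
  have f': "f \<in> iso G G" "preserves_pairing G G f"
    using f by (auto simp: Sp_iff)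
  have closed: "k \<in> carrier H \<rightarrow> carrier G" "f \<circ> k \<in> carrier H \<rightarrow> carrier G"
    using k(1) f'(1) by (auto simp: iso_def hom_def)
  show "h \<circ> f \<circ> k \<in> iso H H"
    unfolding comp_assoc using k(1) f'(1) h(1) by (intro iso_set_trans)
  show "preserves_pairing H H (h \<circ> f \<circ> k)"
    unfolding comp_assoc using closed k(2) f'(2) h(2) by (intro preserves_pairing_comp)
qed fact

text \<open>Conjugation by an isomorphism \<open>h\<close> is a bijection, with conjugation by its
  inverse \<open>k\<close> as inverse.\<close>

lemma card_Sp_cong:
  assumes "group G" "group H" "G \<simeq>\<^sub>s H"
  shows "card (Sp G) = card (Sp H)"
proof -
  obtain h where h: "h \<in> iso G H" "preserves_pairing G H h"
    using assms(3) by (rule symplectic_isomorphicE)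
  have bij: "bij_betw h (carrier G) (carrier H)"
    using h(1) by (simp add: iso_def)
  define k where "k = inv_into (carrier G) h"
  have k: "k \<in> iso H G" "preserves_pairing H G k"
    using group.iso_set_sym[OF assms(1) h(1)] preserves_pairing_inv_into[OF bij h(2)] by (auto simp: k_def)
  have kh: "k (h x) = x" "h x \<in> carrier H" if "x \<in> carrier G" for x
    using bij that by (auto simp: k_def bij_betw_inv_into_left bij_betwE)
  have hk: "h (k y) = y" "k y \<in> carrier G" if "y \<in> carrier H" for y
    using bij that bij_betwE[OF bij_betw_inv_into[OF bij]] by (auto simp: k_def bij_betw_inv_into_right)
  have "bij_betw (\<lambda>f. restrict (h \<circ> f \<circ> k) (carrier H)) (Sp G) (Sp H)"
  proof (rule bij_betw_byWitness[where f' = "\<lambda>f. restrict (k \<circ> f \<circ> h) (carrier G)"])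
    show "\<forall>f\<in>Sp G. restrict (k \<circ> restrict (h \<circ> f \<circ> k) (carrier H) \<circ> h) (carrier G) = f"
    proof
      fix f assume "f \<in> Sp G"
      then have f: "f \<in> extensional (carrier G)" "\<And>x. x \<in> carrier G \<Longrightarrow> f x \<in> carrier G"
        by (auto simp: Sp_iff iso_def hom_def)
      show "restrict (k \<circ> restrict (h \<circ> f \<circ> k) (carrier H) \<circ> h) (carrier G) = f"
        by (rule extensionalityI[OF restrict_extensional f(1)]) (simp add: kh f(2))
    qed
    show "\<forall>f\<in>Sp H. restrict (h \<circ> restrict (k \<circ> f \<circ> h) (carrier G) \<circ> k) (carrier H) = f"
    proof
      fix f assume "f \<in> Sp H"
      then have f: "f \<in> extensional (carrier H)" "\<And>x. x \<in> carrier H \<Longrightarrow> f x \<in> carrier H"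
        by (auto simp: Sp_iff iso_def hom_def)
      show "restrict (h \<circ> restrict (k \<circ> f \<circ> h) (carrier G) \<circ> k) (carrier H) = f"
        by (rule extensionalityI[OF restrict_extensional f(1)]) (simp add: hk f(2))
    qed
  qed (use conjugate_in_Sp[OF assms(2) h k] conjugate_in_Sp[OF assms(1) k h] in auto)
  then show ?thesis by (rule bij_betw_same_card)
qed

lemma order_cong:
  assumes "G \<simeq>\<^sub>s H"
  shows "order G = order H"
  using assms by (auto simp: symplectic_isomorphic_def order_def iso_def dest: bij_betw_same_card)

lemma card_Sp_trivial:
  assumes "group G" "carrier G = {\<one>\<^bsub>G\<^esub>}"
  shows "card (Sp G) = 1"
proof -
  have "restrict id (carrier G) \<in> Sp G"
    using assms(1) by (rule restrict_in_Sp) (auto simp: id_iso preserves_pairing_def)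
  moreover have "f = restrict id (carrier G)" if "f \<in> Sp G" for f
  proof (rule extensionalityI)
    show "f x = restrict id (carrier G) x" if "x \<in> carrier G" for x
    proof -
      have "f x \<in> carrier G"
        using \<open>f \<in> Sp G\<close> that by (auto simp: Sp_iff iso_def hom_def)
      then show ?thesis
        using that assms(2) by auto
    qed
  qed (use that in \<open>auto simp: Sp_iff\<close>)
  ultimately have "Sp G = {restrict id (carrier G)}" by blast
  then show ?thesis by simp
qed

section \<open>Multiplicativity of the order and of the number of symplectic automorphisms\<close>

context symplectic_abelian_group
begin

text \<open>Here the summands are the primary parts themselves, so \<open>assemble\<close> applies
  \<open>f p\<close> to each primary component and multiplies the results.\<close>

lemma primary_family_primary_parts:
  assumes "\<And>p. p \<in> prime_factors (order G) \<Longrightarrow> f p \<in> Sp (primary_part p G)"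
  shows "primary_family (prime_factors (order G)) (\<lambda>p. primary_part p G) G f"
  using assms symplectic_p_groupD(1)[OF symplectic_p_group_primary_part] symplectic_abelian_group_axioms
  by (intro primary_family.intro symplectic_family.intro primary_family_axioms.intro)
    (auto simp: Sp_iff)

lemma id_in_Sp: "restrict id (carrier G) \<in> Sp G"
  using is_group by (rule restrict_in_Sp) (auto simp: id_iso preserves_pairing_def)

text \<open>With identities for \<open>f\<close>, \<open>assemble\<close> is a bijection. Over a
  finite index set the finite support condition is void, so its domain is the full product.\<close>

lemma order_eq_prod_primary_parts:
  "order G = (\<Prod>p\<in>prime_factors (order G). order (primary_part p G))"
proof -
  let ?S = "prime_factors (order G)" and ?P = "\<lambda>p. primary_part p G"
  have id: "restrict id (carrier (?P p)) \<in> Sp (?P p)" if "p \<in> ?S" for p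
    using that symplectic_p_groupD(1)[OF symplectic_p_group_primary_part]
    by (auto intro: symplectic_abelian_group.id_in_Sp)
  interpret primary_family ?S ?P G "\<lambda>p. restrict id (carrier (?P p))"
    using id by (rule primary_family_primary_parts)
  have "order G = card (carrier (direct_sum ?S ?P))"
    using assemble_iso by (auto simp: order_def iso_def dest: bij_betw_same_card)
  also have "carrier (direct_sum ?S ?P) = (\<Pi>\<^sub>E p\<in>?S. carrier (?P p))"
    by (auto simp: carrier_direct_sum)
  also have "card \<dots> = (\<Prod>p\<in>?S. order (?P p))"
    by (simp add: card_PiE order_def)
  finally show ?thesis .
qed

text \<open>A homomorphism preserves being killed by a power of \<open>p\<close>, and an injective
  self-map of the finite part is onto.\<close>

lemma Sp_restrict_primary_part:
  assumes "prime p" "f \<in> Sp G"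
  shows "restrict f (carrier (primary_part p G)) \<in> Sp (primary_part p G)"
proof (rule restrict_in_Sp)
  let ?P = "primary_part p G"
  have f: "f \<in> hom G G" "inj_on f (carrier G)" "preserves_pairing G G f"
    using assms(2) by (auto simp: Sp_iff iso_def bij_betw_def)
  show "group ?P"
    using comm_group_primary_part by (simp add: comm_group_def)
  have closed: "f x \<in> carrier ?P" if x: "x \<in> carrier ?P" for x
  proof -
    obtain k where k: "x \<in> carrier G" "x [^] (p ^ k) = \<one>"
      using x by (auto simp: mem_primary_part)
    then have "f x [^] (p ^ k) = \<one>"
      using hom_nat_pow[OF f(1) is_group is_group k(1), of "p ^ k"] hom_one[OF f(1) is_group is_group]
      by simp
    then show ?thesis
      using f(1) k(1) by (auto simp: mem_primary_part hom_def)
  qed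
  have "inj_on f (carrier ?P)"
    using f(2) primary_part_subset by (rule inj_on_subset)
  moreover from this have "f ` carrier ?P = carrier ?P"
    using closed finite_primary_part by (intro endo_inj_surj) auto
  ultimately show "f \<in> iso ?P ?P"
    using f(1) closed by (auto simp: iso_def hom_def bij_betw_def mem_primary_part)
  show "preserves_pairing ?P ?P f"
    using f(3) by (simp add: preserves_pairing_def mem_primary_part)
qed

text \<open>Restriction to all primary parts is a bijection onto the product of their
  \<open>Sp\<close>: injective because the parts generate \<open>G\<close>, surjective because a
  family of automorphisms can be glued.\<close>

lemma card_Sp_eq_prod_primary_parts:
  "card (Sp G) = (\<Prod>p\<in>prime_factors (order G). card (Sp (primary_part p G)))"
proof -
  let ?S = "prime_factors (order G)" and ?P = "\<lambda>p. primary_part p G"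
  let ?\<Phi> = "\<lambda>f. \<lambda>p\<in>?S. restrict f (carrier (?P p))"
  have id: "restrict id (carrier (?P p)) \<in> Sp (?P p)" if "p \<in> ?S" for p
    using that symplectic_p_groupD(1)[OF symplectic_p_group_primary_part]
    by (auto intro: symplectic_abelian_group.id_in_Sp)
  interpret A: primary_family ?S ?P G "\<lambda>p. restrict id (carrier (?P p))"
    using id by (rule primary_family_primary_parts)
  have "bij_betw ?\<Phi> (Sp G) (\<Pi>\<^sub>E p\<in>?S. Sp (?P p))"
    unfolding bij_betw_def
  proof
    show "inj_on ?\<Phi> (Sp G)"
    proof (rule inj_onI)
      fix f g assume fg: "f \<in> Sp G" "g \<in> Sp G" and eq: "?\<Phi> f = ?\<Phi> g"
      have hom: "f \<in> hom G G" "g \<in> hom G G"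
        using fg by (auto simp: Sp_iff iso_def)
      show "f = g"
      proof (rule extensionalityI)
        fix z assume "z \<in> carrier G"
        then obtain y where y: "\<And>p. p \<in> ?S \<Longrightarrow> y p \<in> carrier (?P p)" "z = finprod G y ?S"
          using primary_decomposition by blast
        then have yG: "y \<in> ?S \<rightarrow> carrier G"
          using primary_part_subset by blast
        have "f (y p) = g (y p)" if "p \<in> ?S" for p
        proof -
          have "restrict f (carrier (?P p)) = restrict g (carrier (?P p))"
            using fun_cong[OF eq, of p] that by simp
          from fun_cong[OF this, of "y p"] show ?thesis
            using y(1)[OF that] by simp
        qed
        then have "finprod G (\<lambda>p. f (y p)) ?S = finprod G (\<lambda>p. g (y p)) ?S"
          using yG hom by (intro finprod_cong') (auto simp: hom_def)
        then show "f z = g z"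
          unfolding y(2) using hom_finprod[OF _ comm_group_axioms comm_group_axioms yG] hom by simp
      qed (use fg in \<open>auto simp: Sp_iff\<close>)
    qed
    show "?\<Phi> ` Sp G = (\<Pi>\<^sub>E p\<in>?S. Sp (?P p))"
    proof
      show "?\<Phi> ` Sp G \<subseteq> (\<Pi>\<^sub>E p\<in>?S. Sp (?P p))"
        using Sp_restrict_primary_part by (auto simp: in_prime_factors_iff)
      show "(\<Pi>\<^sub>E p\<in>?S. Sp (?P p)) \<subseteq> ?\<Phi> ` Sp G"
      proof
        fix F assume F: "F \<in> (\<Pi>\<^sub>E p\<in>?S. Sp (?P p))"
        interpret B: primary_family ?S ?P G F
          using F by (intro primary_family_primary_parts) auto
        let ?D = "direct_sum ?S ?P"
        interpret D: comm_group ?D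
          by (rule A.comm_group_direct_sum)
        define u where "u = inv_into (carrier ?D) A.assemble"
        have bij: "bij_betw A.assemble (carrier ?D) (carrier G)"
          using A.assemble_iso by (simp add: iso_def)
        have u: "u \<in> iso G ?D" "preserves_pairing G ?D u"
          using D.iso_set_sym[OF A.assemble_iso] A.assemble_pairing
            preserves_pairing_inv_into[OF bij] by (auto simp: u_def preserves_pairing_def)
        \<comment> \<open>The map \<open>u\<close> splits an element into its primary components;
          \<open>B.assemble\<close> then applies \<open>F p\<close> to each of them and
          multiplies.\<close>
        define g where "g = restrict (B.assemble \<circ> u) (carrier G)"
        have "g \<in> Sp G"
          unfolding g_def
        proof (rule restrict_in_Sp[OF is_group])
          show "B.assemble \<circ> u \<in> iso G G"
            using u(1) B.assemble_iso by (rule iso_set_trans)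
          show "preserves_pairing G G (B.assemble \<circ> u)"
            using u B.assemble_pairing
            by (intro preserves_pairing_comp[of _ _ ?D]) (auto simp: iso_def hom_def preserves_pairing_def)
        qed
        moreover have "?\<Phi> g = F"
        proof (rule PiE_ext)
          show "?\<Phi> g \<in> (\<Pi>\<^sub>E p\<in>?S. Sp (?P p))"
            using Sp_restrict_primary_part \<open>g \<in> Sp G\<close> by (auto simp: in_prime_factors_iff)
          show "F \<in> (\<Pi>\<^sub>E p\<in>?S. Sp (?P p))" by fact
          fix p assume p: "p \<in> ?S"
          have "g x = F p x" if x: "x \<in> carrier (?P p)" for x
          proof -
            \<comment> \<open>Hence \<open>u\<close> sends an element of the p-part to the summand
              at \<open>p\<close>, where \<open>B.assemble\<close> acts as
              \<open>F p\<close>.\<close>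
            have "A.assemble (A.single p x) = x"
              using A.assemble_single[OF p x] x by simp
            then have "u x = A.single p x"
              using bij_betw_inv_into_left[OF bij A.single_in_carrier[OF p x]] by (simp add: u_def)
            then show ?thesis
              using x primary_part_subset B.assemble_single[OF p x] by (auto simp: g_def)
          qed
          moreover have "F p \<in> extensional (carrier (?P p))"
            using F p by (auto simp: Sp_iff)
          ultimately show "?\<Phi> g p = F p"
            using p by (auto intro!: extensionalityI[of _ "carrier (?P p)"])
        qed
        ultimately show "F \<in> ?\<Phi> ` Sp G" by (intro image_eqI[of F _ g]) (rule sym, assumption+)
      qed
    qed
  qed
  from bij_betw_same_card[OF this] show ?thesis
    by (simp add: card_PiE)
qed

end

section \<open>Local probabilities and weights\<close>

lemma local_prob_cong:
  assumes "group G" "group H" "G \<simeq>\<^sub>s H"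
  shows "local_prob r p G = local_prob r p H"
  using order_cong[OF assms(3)] card_Sp_cong[OF assms] by (simp add: local_prob_def)

lemma power_int_prod:
  fixes f :: "'a \<Rightarrow> 'b::field"
  shows "(\<Prod>x\<in>A. f x) powi n = (\<Prod>x\<in>A. f x powi n)"
  by (induction A rule: infinite_finite_induct) (auto simp: power_int_mult_distrib)

lemma (in symplectic_abelian_group) delaunay_weight_eq_prod:
  "delaunay_weight (real r) G = (\<Prod>p\<in>prime_factors (order G).
     real (order (primary_part p G)) powi (1 - int r) / real (card (Sp (primary_part p G))))"
proof -
  \<comment> \<open>The weight has a real exponent and the local probability an integer one; they
    agree because the order is positive.\<close>
  have "real (order G) powr (1 - real r) = real (order G) powr real_of_int (1 - int r)"
    by simp
  also have "\<dots> = real (order G) powi (1 - int r)"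
    using order_pos by (subst powr_real_of_int') auto
  also have "\<dots> = (\<Prod>p\<in>prime_factors (order G). real (order (primary_part p G)) powi (1 - int r))"
    using arg_cong[OF order_eq_prod_primary_parts, of "\<lambda>n. real n powi (1 - int r)"]
    by (simp add: power_int_prod)
  finally show ?thesis
    by (simp add: delaunay_weight_def card_Sp_eq_prod_primary_parts prod_dividef)
qed

section \<open>The random group\<close>

text \<open>The product over i \<ge> r + 1 of 1 - p^(1 - 2i), with i = r + 1 + j. It is also the
  probability that the p-component is trivial.\<close>

definition euler_factor :: "nat \<Rightarrow> nat \<Rightarrow> real" where
  "euler_factor r p = (\<Prod>j. 1 - real p powi (1 - 2 * int (r + 1 + j)))"

text \<open>The Weierstrass inequality bounds a product of factors 1 - a_j below by 1 minus the sum
  of the a_j, and a geometric series bounds that sum by 1 / p^2.\<close>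

lemma euler_factor_bounds:
  assumes "r \<ge> 1" "p \<ge> 2"
  shows "1 - 1 / real p ^ 2 \<le> euler_factor r p" "euler_factor r p \<le> 1"
proof -
  define a where "a j = real p powi (1 - 2 * int (r + 1 + j))" for j
  have a_eq: "a j = 1 / real p ^ (2 * r + 1 + 2 * j)" for j
  proof -
    have "1 - 2 * int (r + 1 + j) = - int (2 * r + 1 + 2 * j)" by simp
    then show ?thesis by (simp only: a_def power_int_minus power_int_of_nat inverse_eq_divide)
  qed
  \<comment> \<open>From r \<ge> 1 the exponent 2r + 1 + 2j is at least 2 + (j + 1), and p \<ge> 2
    turns the last j + 1 factors into halves, whose series sums to 1.\<close>
  have a_le: "a j \<le> 1 / real p ^ 2 * (1 / 2) ^ Suc j" for j
  proof -
    have "real p ^ 2 * 2 ^ Suc j \<le> real p ^ 2 * real p ^ Suc j"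
      using assms(2) by (intro mult_left_mono power_mono) auto
    also have "\<dots> = real p ^ (2 + Suc j)" by (simp only: power_add)
    also have "\<dots> \<le> real p ^ (2 * r + 1 + 2 * j)"
      using assms by (intro power_increasing) auto
    finally show ?thesis
      using assms(2) by (simp add: a_eq power_one_over frac_le)
  qed
  have a_nonneg: "a j \<ge> 0" for j
    by (simp add: a_eq)
  have geom: "(\<lambda>j. 1 / real p ^ 2 * (1 / 2) ^ Suc j) sums (1 / real p ^ 2 * 1)"
    by (intro sums_mult power_half_series)
  have a_summable: "summable a"
    using sums_summable[OF geom] by (rule summable_comparison_test') (use a_le a_nonneg in auto)
  have a_sum: "sum a {..n} \<le> 1 / real p ^ 2" for n
  proof -
    have "sum a {..n} \<le> suminf a"
      using a_summable a_nonneg by (intro sum_le_suminf) auto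
    also have "\<dots> \<le> 1 / real p ^ 2"
      using suminf_le[OF a_le a_summable sums_summable[OF geom]] sums_unique[OF geom] by simp
    finally show ?thesis .
  qed
  have a_le_1: "a j \<le> 1" for j
  proof -
    have "1 \<le> real p ^ (2 * r + 1 + 2 * j)"
      using assms(2) by (intro one_le_power) auto
    then have "1 / real p ^ (2 * r + 1 + 2 * j) \<le> 1 / 1"
      by (intro frac_le) auto
    then show ?thesis by (simp only: a_eq div_by_1)
  qed
  \<comment> \<open>The infinite product is known to be the limit of its partial products only once
    convergence is established.\<close>
  have "abs_convergent_prod (\<lambda>j. 1 - a j)"
    using a_summable a_nonneg by (simp add: abs_convergent_prod_conv_summable)
  then have lim: "(\<lambda>n. \<Prod>j\<le>n. 1 - a j) \<longlonglongrightarrow> euler_factor r p"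
    unfolding euler_factor_def a_def
    by (intro convergent_prod_LIMSEQ abs_convergent_prod_imp_convergent_prod)
  have "1 - 1 / real p ^ 2 \<le> (\<Prod>j\<le>n. 1 - a j)" for n
    using Weierstrass_prod_ineq[of "{..n}" a] a_sum[of n] a_nonneg a_le_1 by (auto intro: order_trans)
  then show "1 - 1 / real p ^ 2 \<le> euler_factor r p"
    using lim by (intro LIMSEQ_le_const) auto
  have "(\<Prod>j\<le>n. 1 - a j) \<le> 1" for n
    using a_nonneg a_le_1 by (intro prod_le_1) auto
  then show "euler_factor r p \<le> 1"
    using lim by (intro LIMSEQ_le_const2) auto
qed

text \<open>Used twice: for the convergence of the product over all primes, and as the hypothesis of
  Borel--Cantelli.\<close>

lemma summable_euler_factors:
  assumes "r \<ge> 1"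
  shows "summable (\<lambda>p. norm ((if prime p then euler_factor r p else 1) - 1))"
proof (rule summable_comparison_test')
  show "summable (\<lambda>p. inverse (real p ^ 2))"
    by (rule inverse_power_summable) simp
  show "norm (norm ((if prime p then euler_factor r p else 1) - 1)) \<le> inverse (real p ^ 2)" for p
    using euler_factor_bounds[OF assms prime_ge_2_nat, of p] by (auto simp: inverse_eq_divide)
qed

lemma local_prob_eq:
  "local_prob r p G = real (order G) powi (1 - int r) / real (card (Sp G)) * euler_factor r p"
  by (simp add: local_prob_def euler_factor_def)

text \<open>Each factor is split as \<open>w p\<close> times the Euler factor. The first differs
  from 1 at only finitely many primes and multiplies to the weight of \<open>G\<close>; the second
  does not depend on \<open>G\<close>.\<close>

lemma (in symplectic_abelian_group) local_prob_has_prod: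
  assumes "r \<ge> 1"
  shows "(\<lambda>p. if prime p then local_prob r p (primary_part p G) else 1) has_prod
    (delaunay_weight (real r) G * (\<Prod>p. if prime p then euler_factor r p else 1))"
proof -
  let ?S = "prime_factors (order G)"
  define w where "w p = (if p \<in> ?S then
    real (order (primary_part p G)) powi (1 - int r) / real (card (Sp (primary_part p G))) else 1)" for p
  have "w has_prod (\<Prod>p\<in>?S. w p)"
    by (rule has_prod_finite) (auto simp: w_def)
  also have "(\<Prod>p\<in>?S. w p) = delaunay_weight (real r) G"
    by (simp add: delaunay_weight_eq_prod w_def)
  finally have w: "w has_prod delaunay_weight (real r) G" .
  have "convergent_prod (\<lambda>p. if prime p then euler_factor r p else 1)"
    using summable_euler_factors[OF assms]
    by (intro abs_convergent_prod_imp_convergent_prod) (simp add: abs_convergent_prod_conv_summable)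
  then have "(\<lambda>p. w p * (if prime p then euler_factor r p else 1)) has_prod
      (delaunay_weight (real r) G * (\<Prod>p. if prime p then euler_factor r p else 1))"
    by (intro has_prod_mult w convergent_prod_has_prod)
  also have "(\<lambda>p. w p * (if prime p then euler_factor r p else 1)) =
      (\<lambda>p. if prime p then local_prob r p (primary_part p G) else 1)"
  proof
    fix p
    \<comment> \<open>At a prime not dividing the order the primary part is trivial, so its local
      probability is the Euler factor alone.\<close>
    consider "p \<in> ?S" | "prime p" "p \<notin> ?S" | "\<not> prime p" "p \<notin> ?S"
      using in_prime_factors_imp_prime by blast
    then show "w p * (if prime p then euler_factor r p else 1) =
        (if prime p then local_prob r p (primary_part p G) else 1)"
    proof cases
      case 2
      have "card (Sp (primary_part p G)) = 1"
        using comm_group_primary_part primary_part_eq_one[OF 2]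
        by (intro card_Sp_trivial) (auto simp: comm_group_def)
      with 2 show ?thesis
        by (simp add: w_def local_prob_eq order_def primary_part_eq_one)
    qed (auto simp: w_def local_prob_eq in_prime_factors_iff)
  qed
  finally show ?thesis .
qed

text \<open>A symplectic p-group for every \<open>p\<close>, placed on \<open>nat\<close> so that
  triviality of a random component becomes an isomorphism event covered by the law.\<close>

definition trivial_symplectic :: "nat pairing_group" where
  "trivial_symplectic =
     \<lparr>carrier = {0}, monoid.mult = (\<lambda>_ _. 0), one = 0, pairing = (\<lambda>_ _. \<one>\<^bsub>QZ\<^esub>)\<rparr>"

lemma symplectic_p_group_trivial: "symplectic_p_group p trivial_symplectic"
proof -
  have "comm_group trivial_symplectic"
    by (rule comm_groupI) (auto simp: trivial_symplectic_def)
  then have "symplectic_abelian_group trivial_symplectic"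
    by (auto simp: symplectic_abelian_group_def symplectic_abelian_group_axioms_def
        trivial_symplectic_def hom_def)
  then show ?thesis
    by (auto simp: symplectic_p_group_def order_def trivial_symplectic_def intro: exI[of _ 0])
qed

lemma local_prob_trivial: "local_prob r p trivial_symplectic = euler_factor r p"
proof -
  have "group trivial_symplectic"
    using symplectic_p_groupD(1)[OF symplectic_p_group_trivial]
    by (simp add: symplectic_abelian_group_def comm_group_def)
  then have "card (Sp trivial_symplectic) = 1"
    by (rule card_Sp_trivial) (simp add: trivial_symplectic_def)
  then show ?thesis
    by (simp add: local_prob_eq order_def) (simp add: trivial_symplectic_def)
qed

lemma isomorphic_trivialD:
  assumes "group G" "G \<simeq>\<^sub>s trivial_symplectic"
  shows "carrier G = {\<one>\<^bsub>G\<^esub>}"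
proof -
  have "card (carrier G) = 1"
    using order_cong[OF assms(2)] by (simp add: order_def trivial_symplectic_def)
  moreover have "\<one>\<^bsub>G\<^esub> \<in> carrier G"
    using assms(1) by (simp add: group.is_monoid monoid.one_closed)
  ultimately show ?thesis
    by (auto simp: card_1_singleton_iff)
qed

text \<open>Countable additivity yields an integral over a counting measure, whereas
  \<open>delaunay_prob\<close> uses \<open>infsum\<close>; this connects the two.\<close>

lemma infsum_eq_if_nn_integral:
  fixes f :: "'a \<Rightarrow> real"
  assumes "\<And>x. x \<in> A \<Longrightarrow> f x \<ge> 0" "(\<integral>\<^sup>+x. ennreal (f x) \<partial>count_space A) = ennreal S" "S \<ge> 0"
  shows "infsum f A = S"
proof -
  have abs: "Infinite_Set_Sum.abs_summable_on f A"
    unfolding Infinite_Set_Sum.abs_summable_on_def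
    using assms by (intro integrableI_nonneg) (auto simp: AE_count_space)
  have "ennreal S = ennreal (infsetsum f A)"
    using nn_integral_conv_infsetsum[OF abs] assms by simp
  moreover have "infsetsum f A \<ge> 0"
    using assms(1) by (rule infsetsum_nonneg)
  ultimately show ?thesis
    using infsetsum_infsum[OF abs] assms(3) by simp
qed

section \<open>The probability space and the law of the random sum\<close>

abbreviation symplectic_classes :: "nat pairing_group set set" where
  "symplectic_classes \<equiv> iso_class ` {H :: nat pairing_group. symplectic_abelian_group H}"

text \<open>Only the isomorphism class of \<open>T p \<omega>\<close> is a random variable, with
  every set of classes measurable.\<close>

locale random_symplectic_groups = prob_space M for M :: "'w measure" +
  fixes T :: "nat \<Rightarrow> 'w \<Rightarrow> 'a pairing_group" and r :: nat
  assumes r: "r \<ge> 1"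
    and T: "\<And>p \<omega>. prime p \<Longrightarrow> \<omega> \<in> space M \<Longrightarrow> symplectic_p_group p (T p \<omega>)"
    and indep: "indep_vars (\<lambda>p. count_space UNIV) (\<lambda>p \<omega>. iso_class (T p \<omega>)) {p. prime p}"
    and law: "\<And>p (G :: nat pairing_group). prime p \<Longrightarrow> symplectic_p_group p G \<Longrightarrow>
      \<P>(\<omega> in M. T p \<omega> \<simeq>\<^sub>s G) = local_prob r p G"
begin

abbreviation total :: "'w \<Rightarrow> (nat \<Rightarrow> 'a) pairing_group" where
  "total \<omega> \<equiv> direct_sum {p. prime p} (\<lambda>p. T p \<omega>)"

text \<open>The part of the product of local probabilities that does not depend on the group;
  nonprime indices contribute 1.\<close>

definition normalization :: real where
  "normalization = (\<Prod>p. if prime p then euler_factor r p else 1)"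

lemma family: "\<omega> \<in> space M \<Longrightarrow> symplectic_family {p. prime p} (\<lambda>p. T p \<omega>)"
  by (rule symplectic_family.intro) (use symplectic_p_groupD(1)[OF T] in auto)

text \<open>As the preimage of a single class, the event is measurable and falls under the
  independence assumption.\<close>

lemma isomorphic_event:
  fixes G :: "'c pairing_group"
  assumes "prime p" "symplectic_abelian_group G"
  shows "{\<omega> \<in> space M. T p \<omega> \<simeq>\<^sub>s G} = (\<lambda>\<omega>. iso_class (T p \<omega>)) -` {iso_class G} \<inter> space M"
  using iso_class_eq_iff[OF symplectic_p_groupD(1)[OF T[OF assms(1)]] assms(2)] by auto

lemma isomorphic_measurable:
  fixes G :: "'c pairing_group"
  assumes "prime p" "symplectic_abelian_group G"
  shows "{\<omega> \<in> space M. T p \<omega> \<simeq>\<^sub>s G} \<in> events"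
  unfolding isomorphic_event[OF assms]
  using indep assms(1) by (auto simp: indep_vars_def intro!: measurable_sets)

text \<open>The law is given for groups over \<open>nat\<close>, while the primary parts of
  \<open>G\<close> have the type of \<open>G\<close>; the law is moved along a copy.\<close>

lemma prob_isomorphic:
  fixes G :: "'c pairing_group"
  assumes "prime p" "symplectic_p_group p G"
  shows "\<P>(\<omega> in M. T p \<omega> \<simeq>\<^sub>s G) = local_prob r p G"
proof -
  note G = symplectic_p_groupD(1)[OF assms(2)]
  obtain H :: "nat pairing_group" where H: "symplectic_abelian_group H" "H \<simeq>\<^sub>s G"
    using ex_nat_copy[OF G] by blast
  have groups: "group G" "group H"
    using G H(1) by (auto simp: symplectic_abelian_group_def comm_group_def)
  have "symplectic_p_group p H"
    using assms(2) H order_cong[OF H(2)] by (simp add: symplectic_p_group_def)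
  then have "\<P>(\<omega> in M. T p \<omega> \<simeq>\<^sub>s H) = local_prob r p H"
    by (rule law[OF assms(1)])
  also have "{\<omega> \<in> space M. T p \<omega> \<simeq>\<^sub>s H} = {\<omega> \<in> space M. T p \<omega> \<simeq>\<^sub>s G}"
    using isomorphic_event[OF assms(1) G] isomorphic_event[OF assms(1) H(1)]
      iso_class_eq_iff[OF H(1) G] H(2) by simp
  also have "local_prob r p H = local_prob r p G"
    using groups H(2) by (intro local_prob_cong)
  finally show ?thesis .
qed

lemma total_isomorphic_iff:
  fixes G :: "'b pairing_group"
  assumes "symplectic_abelian_group G" "\<omega> \<in> space M"
  shows "total \<omega> \<simeq>\<^sub>s G \<longleftrightarrow> (\<forall>p. prime p \<longrightarrow> T p \<omega> \<simeq>\<^sub>s primary_part p G)"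
proof (intro iffI allI impI)
  fix p :: nat assume iso: "total \<omega> \<simeq>\<^sub>s G" and "prime p"
  show "T p \<omega> \<simeq>\<^sub>s primary_part p G"
  proof (rule component_isomorphic_primary_part[where I = "{p. prime p}" and T = "\<lambda>p. T p \<omega>"])
    show "symplectic_abelian_group G" by fact
    show "total \<omega> \<simeq>\<^sub>s G" by fact
    show "prime p" if "p \<in> {p. prime p}" for p
      using that by (rule CollectD)
    show "symplectic_p_group p (T p \<omega>)" if "p \<in> {p. prime p}" for p
      using CollectD[OF that] assms(2) by (rule T)
    show "p \<in> {p. prime p}"
      using \<open>prime p\<close> by (rule CollectI)
  qed
next
  assume iso: "\<forall>p. prime p \<longrightarrow> T p \<omega> \<simeq>\<^sub>s primary_part p G"
  show "total \<omega> \<simeq>\<^sub>s G"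
  proof (rule direct_sum_isomorphicI[OF assms(1)])
    show "symplectic_abelian_group (T p \<omega>)" if "p \<in> {p. prime p}" for p
      using T[OF CollectD[OF that] assms(2)] by (rule symplectic_p_groupD(1))
    show "prime_factors (order G) \<subseteq> {p. prime p}"
      by (rule subsetI, rule CollectI, rule in_prime_factors_imp_prime)
  qed (use iso in blast)+
qed

text \<open>The event is the decreasing limit of the conditions at primes up to n. Independence
  makes their probabilities the partial products, and continuity from above identifies the
  limit.\<close>

lemma
  fixes G :: "'b pairing_group"
  assumes "symplectic_abelian_group G"
  shows total_isomorphic_measurable: "{\<omega> \<in> space M. total \<omega> \<simeq>\<^sub>s G} \<in> events"
    and prob_total_isomorphic:
      "\<P>(\<omega> in M. total \<omega> \<simeq>\<^sub>s G) = delaunay_weight (real r) G * normalization"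
proof -
  interpret G: symplectic_abelian_group G by fact
  note P = G.symplectic_p_group_primary_part
  let ?f = "\<lambda>p. if prime p then local_prob r p (primary_part p G) else 1"
  define A where "A p = (if prime p then {\<omega> \<in> space M. T p \<omega> \<simeq>\<^sub>s primary_part p G} else space M)" for p
  have A: "A p \<in> events" for p
    using isomorphic_measurable[OF _ symplectic_p_groupD(1)[OF P]] by (simp add: A_def)
  have A_iff: "\<omega> \<in> A p \<longleftrightarrow> \<omega> \<in> space M \<and> (prime p \<longrightarrow> T p \<omega> \<simeq>\<^sub>s primary_part p G)" for p \<omega>
    by (simp add: A_def)
  have "(\<Inter>n. \<Inter>p\<le>n. A p) = (\<Inter>p. A p)"
    by blast
  also have "\<dots> = {\<omega> \<in> space M. total \<omega> \<simeq>\<^sub>s G}"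
    using total_isomorphic_iff[OF assms] A_iff by blast
  finally have all: "{\<omega> \<in> space M. total \<omega> \<simeq>\<^sub>s G} = (\<Inter>n. \<Inter>p\<le>n. A p)" ..
  show "{\<omega> \<in> space M. total \<omega> \<simeq>\<^sub>s G} \<in> events"
    unfolding all using A by auto
  have partial: "prob (\<Inter>p\<le>n. A p) = (\<Prod>p\<le>n. ?f p)" for n
  proof -
    let ?J = "{p \<in> {..n}. prime p}"
    have "prob (\<Inter>p\<le>n. A p) = (\<Prod>p\<in>?J. local_prob r p (primary_part p G))"
    \<comment> \<open>Without primes up to n the intersection is the whole space; the product rule
      for independent variables needs a nonempty index set.\<close>
    proof (cases "?J = {}")
      case True
      then have "A p = space M" if "p \<le> n" for p
        using that by (auto simp: A_def)
      then have "(\<Inter>p\<le>n. A p) = space M"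
        by auto
      then show ?thesis
        unfolding True by (simp add: prob_space)
    next
      case False
      have A_eq: "A p = (\<lambda>\<omega>. iso_class (T p \<omega>)) -` {iso_class (primary_part p G)} \<inter> space M"
        if "prime p" for p
        using isomorphic_event[OF that symplectic_p_groupD(1)[OF P]] that by (simp add: A_def)
      have "(\<Inter>p\<le>n. A p) = (\<Inter>p\<in>?J. A p)"
        using False A_iff by blast
      also have "\<dots> = (\<Inter>p\<in>?J. (\<lambda>\<omega>. iso_class (T p \<omega>)) -` {iso_class (primary_part p G)} \<inter> space M)"
        by (intro INF_cong) (auto simp: A_eq)
      also have "prob \<dots> = (\<Prod>p\<in>?J. prob ((\<lambda>\<omega>. iso_class (T p \<omega>)) -` {iso_class (primary_part p G)} \<inter> space M))"
        using False by (intro indep_varsD[OF indep]) auto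
      also have "\<dots> = (\<Prod>p\<in>?J. local_prob r p (primary_part p G))"
        using prob_isomorphic[OF _ P] isomorphic_event[OF _ symplectic_p_groupD(1)[OF P]]
        by (intro prod.cong) auto
      finally show ?thesis .
    qed
    also have "\<dots> = (\<Prod>p\<le>n. ?f p)"
      by (rule prod.inter_filter) simp
    finally show ?thesis .
  qed
  have "(\<lambda>n. prob (\<Inter>p\<le>n. A p)) \<longlonglongrightarrow> \<P>(\<omega> in M. total \<omega> \<simeq>\<^sub>s G)"
    unfolding all using A by (intro finite_Lim_measure_decseq) (auto simp: decseq_def)
  moreover have "?f has_prod (delaunay_weight (real r) G * normalization)"
    unfolding normalization_def by (rule G.local_prob_has_prod[OF r])
  then have "(\<lambda>n. \<Prod>p\<le>n. ?f p) \<longlonglongrightarrow> delaunay_weight (real r) G * normalization"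
    using convergent_prod_LIMSEQ[of ?f] by (simp add: has_prod_iff)
  ultimately show "\<P>(\<omega> in M. total \<omega> \<simeq>\<^sub>s G) = delaunay_weight (real r) G * normalization"
    unfolding partial by (rule LIMSEQ_unique)
qed

section \<open>Almost sure finiteness and total mass\<close>

lemma AE_finite_total: "AE \<omega> in M. finite (carrier (total \<omega>))"
proof -
  define A where "A p = (if prime p then space M - {\<omega> \<in> space M. T p \<omega> \<simeq>\<^sub>s trivial_symplectic} else {})" for p
  note triv = symplectic_p_groupD(1)[OF symplectic_p_group_trivial]
  have A: "A p \<in> events" for p
    using isomorphic_measurable[OF _ triv] by (auto simp: A_def)
  \<comment> \<open>The event \<open>A p\<close> says that the component at \<open>p\<close> is
    nontrivial, so its probability is 1 minus the Euler factor; the norm matches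
    \<open>summable_euler_factors\<close>.\<close>
  have "prob (A p) = norm ((if prime p then euler_factor r p else 1) - 1)" for p
    using prob_compl[OF isomorphic_measurable[OF _ triv]] prob_isomorphic[OF _ symplectic_p_group_trivial]
      euler_factor_bounds(2)[OF r prime_ge_2_nat]
    by (auto simp: A_def local_prob_trivial)
  then have "summable (\<lambda>p. prob (A p))"
    using summable_euler_factors[OF r] by simp
  then have "AE \<omega> in M. eventually (\<lambda>p. \<omega> \<in> space M - A p) sequentially"
    using A by (intro borel_cantelli_AE1) (auto simp: less_top[symmetric])
  then show ?thesis
  proof (rule AE_mp, intro AE_I2 impI)
    fix \<omega> assume \<omega>: "\<omega> \<in> space M" and "eventually (\<lambda>p. \<omega> \<in> space M - A p) sequentially"
    then obtain N where N: "\<And>p. p \<ge> N \<Longrightarrow> \<omega> \<notin> A p"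
      by (auto simp: eventually_sequentially)
    interpret symplectic_family "{p. prime p}" "\<lambda>p. T p \<omega>"
      using \<omega> by (rule family)
    have "carrier (T p \<omega>) = {\<one>\<^bsub>T p \<omega>\<^esub>}" if "prime p" "p \<ge> N" for p
      using N[OF that(2)] that(1) \<omega> group[of p] by (intro isomorphic_trivialD) (auto simp: A_def)
    then have "{p \<in> {p. prime p}. carrier (T p \<omega>) \<noteq> {\<one>\<^bsub>T p \<omega>\<^esub>}} \<subseteq> {..<N}"
      by (auto simp: not_le[symmetric])
    then show "finite (carrier (total \<omega>))"
      by (intro finite_direct_sum) (rule finite_subset, auto)
  qed
qed

text \<open>\<open>delaunay_prob\<close> evaluates weights at chosen members. The choice succeeds
  because a group over \<open>nat\<close> belongs to its own class.\<close>

lemma representative: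
  assumes "C \<in> symplectic_classes"
  shows "symplectic_abelian_group (SOME H. H \<in> C)" "iso_class (SOME H. H \<in> C) = C"
proof -
  obtain K :: "nat pairing_group" where K: "symplectic_abelian_group K" "C = iso_class K"
    using assms by auto
  have "K \<in> C"
    using K by (simp add: iso_class_def symplectic_isomorphic_refl)
  then have "(SOME H. H \<in> C) \<in> C"
    by (rule someI)
  then show "symplectic_abelian_group (SOME H. H \<in> C)" "iso_class (SOME H. H \<in> C) = C"
    using iso_class_eq_iff[of "SOME H. H \<in> C" K] K by (auto simp: iso_class_def)
qed

text \<open>A finite sum is itself symplectic and so lies in some class. As there are countably many
  classes, finiteness becomes a measurable event.\<close>

lemma finite_total_eq_Union:
  "{\<omega> \<in> space M. finite (carrier (total \<omega>))} =
    (\<Union>C\<in>symplectic_classes. {\<omega> \<in> space M. total \<omega> \<simeq>\<^sub>s (SOME H. H \<in> C)})"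
proof (intro equalityI subsetI)
  fix \<omega> assume \<omega>: "\<omega> \<in> {\<omega> \<in> space M. finite (carrier (total \<omega>))}"
  interpret symplectic_family "{p. prime p}" "\<lambda>p. T p \<omega>"
    using \<omega> family by auto
  have D: "symplectic_abelian_group (total \<omega>)"
    using \<omega> by (intro symplectic_direct_sum) auto
  obtain H :: "nat pairing_group" where H: "symplectic_abelian_group H" "H \<simeq>\<^sub>s total \<omega>"
    using ex_nat_copy[OF D] by blast
  then have C: "iso_class H \<in> symplectic_classes" by auto
  have "iso_class (SOME K. K \<in> iso_class H) = iso_class (total \<omega>)"
    using representative(2)[OF C] H iso_class_eq_iff[OF H(1) D] by simp
  then have "total \<omega> \<simeq>\<^sub>s (SOME K. K \<in> iso_class H)"
    using iso_class_eq_iff[OF D representative(1)[OF C]] by simp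
  with C \<omega> show "\<omega> \<in> (\<Union>C\<in>symplectic_classes. {\<omega> \<in> space M. total \<omega> \<simeq>\<^sub>s (SOME H. H \<in> C)})"
    by blast
next
  fix \<omega> assume "\<omega> \<in> (\<Union>C\<in>symplectic_classes. {\<omega> \<in> space M. total \<omega> \<simeq>\<^sub>s (SOME H. H \<in> C)})"
  then obtain C where C: "C \<in> symplectic_classes" "\<omega> \<in> space M" "total \<omega> \<simeq>\<^sub>s (SOME H. H \<in> C)"
    by blast
  then have "finite (carrier (total \<omega>))"
    using symplectic_abelian_group.finite_carrier[OF representative(1)[OF C(1)]]
    by (auto simp: symplectic_isomorphic_def iso_def dest: bij_betw_finite)
  with C show "\<omega> \<in> {\<omega> \<in> space M. finite (carrier (total \<omega>))}" by simp
qed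

lemma prob_finite_total: "\<P>(\<omega> in M. finite (carrier (total \<omega>))) = 1"
proof (rule prob_Collect_eq_1[THEN iffD2])
  show "{\<omega> \<in> space M. finite (carrier (total \<omega>))} \<in> events"
    unfolding finite_total_eq_Union
    using total_isomorphic_measurable[OF representative(1)] countable_iso_classes
    by (intro sets.countable_UN') auto
qed (rule AE_finite_total)

text \<open>The normalising constant need not be computed: almost surely \<open>total\<close> lies in exactly one of the
  countably many classes, so the probabilities of the classes add up to 1.\<close>

lemma weights_times_normalization:
  "(\<Sum>\<^sub>\<infinity>C\<in>symplectic_classes. delaunay_weight (real r) (SOME H. H \<in> C)) * normalization = 1"
proof -
  let ?B = "\<lambda>C. {\<omega> \<in> space M. total \<omega> \<simeq>\<^sub>s (SOME H. H \<in> C)}"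
  let ?w = "\<lambda>C. delaunay_weight (real r) (SOME H. H \<in> C)"
  have B: "?B C \<in> events" "prob (?B C) = ?w C * normalization" if "C \<in> symplectic_classes" for C
    using total_isomorphic_measurable prob_total_isomorphic representative(1)[OF that] by blast+
  have "disjoint_family_on ?B symplectic_classes"
    unfolding disjoint_family_on_def
  proof (intro ballI impI)
    fix C C' assume C: "C \<in> symplectic_classes" "C' \<in> symplectic_classes" "C \<noteq> C'"
    have False if \<omega>: "\<omega> \<in> ?B C" "\<omega> \<in> ?B C'" for \<omega>
    proof -
      interpret symplectic_family "{p. prime p}" "\<lambda>p. T p \<omega>"
        using \<omega> family by auto
      have "group (total \<omega>)"
        using comm_group_direct_sum by (simp add: comm_group_def)
      then have "(SOME H. H \<in> C) \<simeq>\<^sub>s total \<omega>"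
        by (rule symplectic_isomorphic_sym) (use \<omega> in blast)
      moreover have "total \<omega> \<simeq>\<^sub>s (SOME H. H \<in> C')"
        using \<omega> by blast
      ultimately have "(SOME H. H \<in> C) \<simeq>\<^sub>s (SOME H. H \<in> C')"
        by (rule symplectic_isomorphic_trans)
      then show False
        using iso_class_eq_iff[OF representative(1)[OF C(1)] representative(1)[OF C(2)]]
          representative(2)[OF C(1)] representative(2)[OF C(2)] C(3) by simp
    qed
    then show "?B C \<inter> ?B C' = {}" by blast
  qed
  then have "emeasure M (\<Union>C\<in>symplectic_classes. ?B C) = (\<integral>\<^sup>+C. emeasure M (?B C) \<partial>count_space symplectic_classes)"
    using B countable_iso_classes by (intro emeasure_UN_countable) auto
  moreover have "emeasure M (\<Union>C\<in>symplectic_classes. ?B C) = ennreal 1"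
    using prob_finite_total unfolding finite_total_eq_Union by (simp add: emeasure_eq_measure)
  moreover have "(\<integral>\<^sup>+C. emeasure M (?B C) \<partial>count_space symplectic_classes) =
      (\<integral>\<^sup>+C. ennreal (?w C * normalization) \<partial>count_space symplectic_classes)"
    using B by (intro nn_integral_cong) (simp add: emeasure_eq_measure)
  ultimately have "(\<integral>\<^sup>+C. ennreal (?w C * normalization) \<partial>count_space symplectic_classes) = ennreal 1"
    by simp
  \<comment> \<open>The terms are nonnegative because each one is a probability.\<close>
  then have "(\<Sum>\<^sub>\<infinity>C\<in>symplectic_classes. ?w C * normalization) = 1"
    using B(2) by (intro infsum_eq_if_nn_integral) (auto simp: measure_nonneg simp flip: B(2))
  then show ?thesis
    by (simp add: infsum_cmult_left')
qed

lemma prob_total_eq_delaunay_prob: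
  fixes G :: "'b pairing_group"
  assumes "symplectic_abelian_group G"
  shows "\<P>(\<omega> in M. total \<omega> \<simeq>\<^sub>s G) = delaunay_prob (real r) G"
proof -
  let ?Z = "\<Sum>\<^sub>\<infinity>C\<in>symplectic_classes. delaunay_weight (real r) (SOME H. H \<in> C)"
  \<comment> \<open>Since the product with \<open>normalization\<close> is 1, \<open>?Z\<close> is
    nonzero; this also excludes the default value 0 of \<open>infsum\<close> for a family that is
    not summable.\<close>
  have "normalization = 1 / ?Z"
    using weights_times_normalization by (metis mult_zero_left nonzero_mult_div_cancel_left zero_neq_one)
  then show ?thesis
    using prob_total_isomorphic[OF assms] by (simp add: delaunay_prob_def)
qed

end

text \<open>With \<open>has_prod\<close>, convergence of the product over the primes is part of the
  claim; the factor 1 at nonprimes lets it run over all natural numbers.\<close>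

theorem theorem5p15:
  fixes M :: "'w measure"
    and T :: "nat \<Rightarrow> 'w \<Rightarrow> 'a pairing_group"
    and r :: nat
  assumes "prob_space M"
    and "r \<ge> 1"
    and "\<And>p \<omega>. prime p \<Longrightarrow> \<omega> \<in> space M \<Longrightarrow> symplectic_p_group p (T p \<omega>)"
    and "prob_space.indep_vars M (\<lambda>p. count_space UNIV) (\<lambda>p \<omega>. iso_class (T p \<omega>)) {p. prime p}"
    and "\<And>p (G :: nat pairing_group). prime p \<Longrightarrow> symplectic_p_group p G \<Longrightarrow>
           \<P>(\<omega> in M. T p \<omega> \<simeq>\<^sub>s G) = local_prob r p G"
  shows "\<P>(\<omega> in M. finite (carrier (direct_sum {p. prime p} (\<lambda>p. T p \<omega>)))) = 1 \<and>
    (\<forall>G :: 'b pairing_group. symplectic_abelian_group G \<longrightarrow>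
       (\<lambda>p. if prime p then local_prob r p (primary_part p G) else 1) has_prod
         \<P>(\<omega> in M. direct_sum {p. prime p} (\<lambda>p. T p \<omega>) \<simeq>\<^sub>s G) \<and>
       \<P>(\<omega> in M. direct_sum {p. prime p} (\<lambda>p. T p \<omega>) \<simeq>\<^sub>s G) = delaunay_prob (real r) G)"
proof -
  interpret random_symplectic_groups M T r
    using assms by (intro random_symplectic_groups.intro random_symplectic_groups_axioms.intro)
  show ?thesis
  proof (intro conjI allI impI)
    fix G :: "'b pairing_group" assume G: "symplectic_abelian_group G"
    show "(\<lambda>p. if prime p then local_prob r p (primary_part p G) else 1) has_prod
        \<P>(\<omega> in M. total \<omega> \<simeq>\<^sub>s G)"
      unfolding prob_total_isomorphic[OF G] normalization_def
      using G r by (rule symplectic_abelian_group.local_prob_has_prod)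
  qed (rule prob_finite_total, rule prob_total_eq_delaunay_prob)
qed

end
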